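(* Let $n\geq 1$. Then $\operatorname{sdepth}(I(\mathcal{P}_{n,3}))>\operatorname{sdepth}(S_{n,3}/I(\mathcal{P}_{n,3}))$.
   Context: $K$ is a field. For a finite simple graph $G$ whose vertices are the variables of a polynomial ring over $K$, the edge ideal $I(G)$ is the squarefree monomial ideal generated by all products $uv$ with $\{u,v\}\in E(G)$. $P_n$ is the path on $n$ vertices ($P_1$ is a single vertex with no edges). The strong product $G_1\boxtimes G_2$ has vertex set $V(G_1)\times V(G_2)$, and two distinct vertices $(v_1,u_1),(v_2,u_2)$ are adjacent iff each coordinate pair is equal or adjacent ($v_1=v_2$ or $v_1v_2\in E(G_1)$, and $u_1=u_2$ or $u_1u_2\in E(G_2)$). Put $\mathcal{P}_{n,m}:=P_n\boxtimes P_m$, with vertices labelled by variables $x_{ij}$ ($1\le i\le n$, $1\le j\le m$), so that distinct $x_{ij},x_{kl}$ are adjacent iff $|i-k|\le 1$ and $|j-l|\le 1$. $S_{n,m}:=K[x_{ij}:1\le i\le n,\ 1\le j\le m]$; $I(\mathcal{P}_{n,m})$ is an ideal of $S_{n,m}$. Stanley depth: let $S=K[x_1,\dots,x_N]$ and $M$ a finitely generated $\mathbb{Z}^N$-graded $S$-module. A Stanley decomposition $\mathcal{D}$ of $M$ is a finite direct sum of $K$-vector spaces $M=\bigoplus_{i=1}^r w_iK[A_i]$ with $w_i\in M$ homogeneous, $A_i\subseteq\{x_1,\dots,x_N\}$, where $w_iK[A_i]$ (the $K$-span of all $w_iu$, $u$ a monomial in $K[A_i]$) is a free $K[A_i]$-module.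 $\operatorname{sdepth}(\mathcal{D})=\min_i|A_i|$ and $\operatorname{sdepth}(M)$ is the maximum of $\operatorname{sdepth}(\mathcal{D})$ over all Stanley decompositions $\mathcal{D}$ of $M$. *)

theory Defs
  imports "HOL-Library.Poly_Mapping" "HOL-Algebra.QuotRing" "HOL-Algebra.Module"
begin

section \<open>Polynomial rings in finitely many variables\<close>

text \<open>
  A monomial is its exponent vector, and a polynomial maps monomials to coefficients.
  The variables of the ring \<open>K[V]\<close> are the elements of a set \<open>V\<close>, which may be smaller than
  the type of all variables.
\<close>

type_synonym ('v, 'k) mpoly = "('v \<Rightarrow>\<^sub>0 nat) \<Rightarrow>\<^sub>0 'k"

definition var :: "'v \<Rightarrow> ('v, 'k::field) mpoly" where
  "var v = Poly_Mapping.single (Poly_Mapping.single v 1) 1"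

definition polys :: "'v set \<Rightarrow> ('v, 'k::field) mpoly set" where
  "polys V = {p. \<forall>u \<in> Poly_Mapping.keys p. Poly_Mapping.keys u \<subseteq> V}"

definition poly_ring :: "'v set \<Rightarrow> ('v, 'k::field) mpoly ring" where
  "poly_ring V = \<lparr>carrier = polys V, mult = (*), one = 1, zero = 0, add = (+)\<rparr>"

section \<open>Multigraded modules\<close>

text \<open>
  With \<open>N\<close> the number of variables, an element of the grading group \<open>\<int>\<^sup>N\<close> is an integer-valued
  function on the variables that vanishes outside \<open>V\<close>.
\<close>

definition multidegrees :: "'v set \<Rightarrow> ('v \<Rightarrow> int) set" where
  "multidegrees V = {a. \<forall>v. v \<notin> V \<longrightarrow> a v = 0}"

definition mdeg :: "('v \<Rightarrow>\<^sub>0 nat) \<Rightarrow> 'v \<Rightarrow> int" where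
  "mdeg u = (\<lambda>v. int (Poly_Mapping.lookup u v))"

definition poly_component :: "'v set \<Rightarrow> ('v \<Rightarrow> int) \<Rightarrow> ('v, 'k::field) mpoly set" where
  "poly_component V a = {p \<in> polys V. \<forall>u \<in> Poly_Mapping.keys p. mdeg u = a}"

text \<open>
  Internal direct sum of a possibly infinite family of subgroups: each element is the sum of exactly
  one finitely supported family of elements of the summands.
\<close>

definition direct_sum :: "('r, 'm) module \<Rightarrow> 'i set \<Rightarrow> ('i \<Rightarrow> 'm set) \<Rightarrow> bool" where
  "direct_sum M I N \<longleftrightarrow>
     (\<forall>i \<in> I. additive_subgroup (N i) M) \<and>
     (\<forall>x \<in> carrier M. \<exists>!f. f \<in> Pi\<^sub>E I N \<and> finite {i \<in> I. f i \<noteq> \<zero>\<^bsub>M\<^esub>} \<and>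
        x = (\<Oplus>\<^bsub>M\<^esub>i \<in> {i \<in> I. f i \<noteq> \<zero>\<^bsub>M\<^esub>}. f i))"

locale multigraded_module =
  fixes V :: "'v set"
    and M :: "(('v, 'k::field) mpoly, 'm) module"
    and gr :: "('v \<Rightarrow> int) \<Rightarrow> 'm set"
  assumes finite_vars: "finite V"
    and is_module: "module (poly_ring V) M"
    and finitely_generated: "\<exists>F. finite F \<and> F \<subseteq> carrier M \<and>
      (\<forall>x \<in> carrier M. \<exists>c \<in> F \<rightarrow> polys V. x = (\<Oplus>\<^bsub>M\<^esub>f \<in> F. c f \<odot>\<^bsub>M\<^esub> f))"
    and grading: "direct_sum M (multidegrees V) gr"
    and graded_smult: "\<lbrakk>a \<in> multidegrees V; b \<in> multidegrees V; p \<in> poly_component V a; x \<in> gr b\<rbrakk>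
      \<Longrightarrow> p \<odot>\<^bsub>M\<^esub> x \<in> gr (\<lambda>v. a v + b v)"

section \<open>Stanley depth\<close>

definition stanley_space ::
  "(('v, 'k::field) mpoly, 'm) module \<Rightarrow> 'm \<Rightarrow> 'v set \<Rightarrow> 'm set" where
  "stanley_space M w A = (\<lambda>p. p \<odot>\<^bsub>M\<^esub> w) ` polys A"

text \<open>
  The space \<open>w K[A]\<close> is generated over \<open>K[A]\<close> by \<open>w\<close>; it is required to be free on \<open>w\<close>,
  which excludes \<open>w = 0\<close>.
\<close>

definition stanley_decomposition ::
  "'v set \<Rightarrow> (('v, 'k::field) mpoly, 'm) module \<Rightarrow> (('v \<Rightarrow> int) \<Rightarrow> 'm set) \<Rightarrow>
   nat \<Rightarrow> (nat \<Rightarrow> 'm) \<Rightarrow> (nat \<Rightarrow> 'v set) \<Rightarrow> bool" where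
  "stanley_decomposition V M gr r w A \<longleftrightarrow>
     (\<forall>i \<in> {1..r}. A i \<subseteq> V \<and> (\<exists>a \<in> multidegrees V. w i \<in> gr a) \<and>
        inj_on (\<lambda>p. p \<odot>\<^bsub>M\<^esub> w i) (polys (A i))) \<and>
     direct_sum M {1..r} (\<lambda>i. stanley_space M (w i) (A i))"

definition decomposition_sdepth :: "nat \<Rightarrow> (nat \<Rightarrow> 'v set) \<Rightarrow> nat" where
  "decomposition_sdepth r A = Min ((\<lambda>i. card (A i)) ` {1..r})"

text \<open>Meaningful for nonzero \<open>M\<close> only: the zero module has just the empty decomposition.\<close>

definition sdepth ::
  "'v set \<Rightarrow> (('v, 'k::field) mpoly, 'm) module \<Rightarrow> (('v \<Rightarrow> int) \<Rightarrow> 'm set) \<Rightarrow> nat" where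
  "sdepth V M gr = Max {decomposition_sdepth r A | r w A. stanley_decomposition V M gr r w A}"

section \<open>Ideals and residue class rings as multigraded modules\<close>

text \<open>
  The rules \<open>multigraded_edge_ideal\<close> and \<open>multigraded_edge_quotient\<close> below show that these are
  multigraded modules when \<open>I\<close> is the edge ideal of a simple graph.
  The fields \<open>mult\<close> and \<open>one\<close> of a module record carry no meaning.
\<close>

definition ideal_module :: "'a ring \<Rightarrow> 'a set \<Rightarrow> ('a, 'a) module" where
  "ideal_module R I = \<lparr>carrier = I, mult = mult R, one = one R, zero = zero R, add = add R,
     smult = mult R\<rparr>"

definition quotient_module :: "'a ring \<Rightarrow> 'a set \<Rightarrow> ('a, 'a set) module" where
  "quotient_module R I = \<lparr>carrier = carrier (R Quot I), mult = mult (R Quot I),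
     one = one (R Quot I), zero = zero (R Quot I), add = add (R Quot I),
     smult = (\<lambda>r X. (I +>\<^bsub>R\<^esub> r) \<otimes>\<^bsub>R Quot I\<^esub> X)\<rparr>"

definition ideal_component ::
  "'v set \<Rightarrow> ('v, 'k::field) mpoly set \<Rightarrow> ('v \<Rightarrow> int) \<Rightarrow> ('v, 'k) mpoly set" where
  "ideal_component V I a = I \<inter> poly_component V a"

definition quotient_component ::
  "'v set \<Rightarrow> ('v, 'k::field) mpoly set \<Rightarrow> ('v \<Rightarrow> int) \<Rightarrow> ('v, 'k) mpoly set set" where
  "quotient_component V I a = (\<lambda>p. I +>\<^bsub>poly_ring V\<^esub> p) ` poly_component V a"

definition sdepth_ideal :: "'v set \<Rightarrow> ('v, 'k::field) mpoly set \<Rightarrow> nat" where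
  "sdepth_ideal V I = sdepth V (ideal_module (poly_ring V) I) (ideal_component V I)"

definition sdepth_quotient :: "'v set \<Rightarrow> ('v, 'k::field) mpoly set \<Rightarrow> nat" where
  "sdepth_quotient V I = sdepth V (quotient_module (poly_ring V) I) (quotient_component V I)"

section \<open>Graphs and edge ideals\<close>

record 'v ugraph =
  verts :: "'v set"
  edges :: "'v set set"

definition simple_graph :: "'v ugraph \<Rightarrow> bool" where
  "simple_graph G \<longleftrightarrow> finite (verts G) \<and> (\<forall>e \<in> edges G. e \<subseteq> verts G \<and> card e = 2)"

definition path_graph :: "nat \<Rightarrow> nat ugraph" where
  "path_graph n = \<lparr>verts = {1..n}, edges = {{i, i + 1} | i. 1 \<le> i \<and> i + 1 \<le> n}\<rparr>"

definition strong_product :: "'a ugraph \<Rightarrow> 'b ugraph \<Rightarrow> ('a \<times> 'b) ugraph" (infixl \<open>\<boxtimes>\<close> 70) where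
  "G \<boxtimes> H = \<lparr>verts = verts G \<times> verts H,
     edges = {{(v, u), (v', u')} | v u v' u'.
       v \<in> verts G \<and> v' \<in> verts G \<and> u \<in> verts H \<and> u' \<in> verts H \<and> (v, u) \<noteq> (v', u') \<and>
       (v = v' \<or> {v, v'} \<in> edges G) \<and> (u = u' \<or> {u, u'} \<in> edges H)}\<rparr>"

definition edge_ideal :: "'v ugraph \<Rightarrow> ('v, 'k::field) mpoly set" where
  "edge_ideal G = Idl\<^bsub>poly_ring (verts G)\<^esub> {var u * var v | u v. {u, v} \<in> edges G}"

definition strong_path :: "nat \<Rightarrow> nat \<Rightarrow> (nat \<times> nat) ugraph" where
  "strong_path n m = path_graph n \<boxtimes> path_graph m"

section \<open>Consistency of the definitions\<close>

lemma strong_path_verts: "verts (strong_path n m) = {1..n} \<times> {1..m}"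
  by (simp add: strong_path_def strong_product_def path_graph_def)

lemma path_graph_edge_iff:
  "{i, j} \<in> edges (path_graph n) \<longleftrightarrow>
     i \<in> {1..n} \<and> j \<in> {1..n} \<and> \<bar>int i - int j\<bar> = 1"
  by (auto simp: path_graph_def doubleton_eq_iff) presburger?

lemma strong_path_edge_iff:
  "{(i, j), (k, l)} \<in> edges (strong_path n m) \<longleftrightarrow>
     i \<in> {1..n} \<and> k \<in> {1..n} \<and> j \<in> {1..m} \<and> l \<in> {1..m} \<and> (i, j) \<noteq> (k, l) \<and>
     \<bar>int i - int k\<bar> \<le> 1 \<and> \<bar>int j - int l\<bar> \<le> 1"
    (is "?L \<longleftrightarrow> ?R")
proof -
  have *: "(a = b \<or> {a, b} \<in> edges (path_graph N)) \<longleftrightarrow> \<bar>int a - int b\<bar> \<le> 1"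
    if "a \<in> {1..N}" "b \<in> {1..N}" for a b N
    using that unfolding path_graph_edge_iff by auto
  have v: "verts (path_graph N) = {1..N}" for N
    by (simp add: path_graph_def)
  have "?L \<longleftrightarrow> (i \<in> {1..n} \<and> k \<in> {1..n} \<and> j \<in> {1..m} \<and> l \<in> {1..m} \<and> (i, j) \<noteq> (k, l) \<and>
      (i = k \<or> {i, k} \<in> edges (path_graph n)) \<and> (j = l \<or> {j, l} \<in> edges (path_graph m)))"
    unfolding strong_path_def strong_product_def v
    by (auto simp: doubleton_eq_iff insert_commute; blast)
  also have "\<dots> \<longleftrightarrow> ?R"
    using *[of i n k] *[of j m l] by blast
  finally show ?thesis .
qed

lemma simple_graph_strong_path: "simple_graph (strong_path n m)"
proof -
  have "e \<subseteq> verts (strong_path n m) \<and> card e = 2" if "e \<in> edges (strong_path n m)" for e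
  proof -
    from that obtain i j k l where e: "e = {(i, j), (k, l)}"
      unfolding strong_path_def strong_product_def by auto
    with that show ?thesis
      unfolding e strong_path_edge_iff by (auto simp: strong_path_verts)
  qed
  then show ?thesis
    by (simp add: simple_graph_def strong_path_verts)
qed

lemma polys_zero: "0 \<in> polys V"
  and polys_one: "1 \<in> polys V"
  and polys_add: "p \<in> polys V \<Longrightarrow> q \<in> polys V \<Longrightarrow> p + q \<in> polys V"
  and polys_uminus: "p \<in> polys V \<Longrightarrow> - p \<in> polys V"
  and polys_single: "Poly_Mapping.keys u \<subseteq> V \<Longrightarrow> Poly_Mapping.single u c \<in> polys V"
  using Poly_Mapping.keys_add[of p q] keys_single[of u c]
  by (auto simp: polys_def in_keys_iff split: if_splits)

lemma polys_mult:
  assumes "p \<in> polys V" "q \<in> polys V"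
  shows "p * q \<in> polys V"
  unfolding polys_def
proof (intro CollectI ballI)
  fix u assume "u \<in> Poly_Mapping.keys (p * q)"
  with keys_mult[of p q] obtain a b
    where u: "u = a + b" and ab: "a \<in> Poly_Mapping.keys p" "b \<in> Poly_Mapping.keys q"
    by blast
  show "Poly_Mapping.keys u \<subseteq> V"
    using Poly_Mapping.keys_add[of a b] ab assms unfolding u polys_def by blast
qed

lemma polys_sum: "(\<And>x. x \<in> A \<Longrightarrow> f x \<in> polys V) \<Longrightarrow> sum f A \<in> polys V"
  by (induction A rule: infinite_finite_induct) (auto simp: polys_zero polys_add)

lemma poly_ring_simps [simp]:
  "carrier (poly_ring V) = polys V" "mult (poly_ring V) = (*)" "one (poly_ring V) = 1"
  "zero (poly_ring V) = 0" "add (poly_ring V) = (+)"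
  by (simp_all add: poly_ring_def)

lemma cring_poly_ring: "cring (poly_ring V :: ('v, 'k::field) mpoly ring)"
proof (rule cringI)
  show "abelian_group (poly_ring V :: ('v, 'k) mpoly ring)"
  proof (rule abelian_groupI)
    fix x :: "('v, 'k) mpoly" assume "x \<in> carrier (poly_ring V)"
    then show "\<exists>y \<in> carrier (poly_ring V). y \<oplus>\<^bsub>poly_ring V\<^esub> x = \<zero>\<^bsub>poly_ring V\<^esub>"
      by (intro bexI[of _ "- x"]) (auto simp: polys_uminus)
  qed (auto simp: polys_add polys_zero add_ac)
  show "comm_monoid (poly_ring V :: ('v, 'k) mpoly ring)"
    by (rule comm_monoidI) (auto simp: polys_mult polys_one mult_ac)
qed (auto simp: distrib_right)

lemma a_inv_poly_ring:
  assumes "p \<in> polys V" shows "\<ominus>\<^bsub>poly_ring V\<^esub> p = - p"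
proof -
  interpret cring "poly_ring V :: ('a, 'b) mpoly ring" by (rule cring_poly_ring)
  show ?thesis using assms by (intro minus_equality) (auto simp: polys_uminus)
qed

lemma additive_subgroupI:
  assumes "abelian_group M" "H \<subseteq> carrier M" "H \<noteq> {}"
    and "\<And>x. x \<in> H \<Longrightarrow> \<ominus>\<^bsub>M\<^esub> x \<in> H" "\<And>x y. x \<in> H \<Longrightarrow> y \<in> H \<Longrightarrow> x \<oplus>\<^bsub>M\<^esub> y \<in> H"
  shows "additive_subgroup H M"
proof (rule additive_subgroup.intro)
  interpret abelian_group M by fact
  show "subgroup H (add_monoid M)"
    by (rule add.subgroupI) (use assms in \<open>simp_all add: a_inv_def[symmetric]\<close>)
qed

lemma ideal_poly_ring_closed:
  assumes "ideal I (poly_ring V)"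
  shows "I \<subseteq> polys V" "0 \<in> I" "p \<in> I \<Longrightarrow> q \<in> I \<Longrightarrow> p + q \<in> I" "p \<in> I \<Longrightarrow> - p \<in> I"
    "p \<in> I \<Longrightarrow> q \<in> polys V \<Longrightarrow> q * p \<in> I"
proof -
  interpret I: ideal I "poly_ring V" by fact
  show sub: "I \<subseteq> polys V" using I.a_subset by simp
  show "0 \<in> I" using additive_subgroup.zero_closed[OF I.is_additive_subgroup] by simp
  show "p \<in> I \<Longrightarrow> q \<in> I \<Longrightarrow> p + q \<in> I" using additive_subgroup.a_closed[OF I.is_additive_subgroup, of p q] by simp
  show mult: "p \<in> I \<Longrightarrow> q \<in> polys V \<Longrightarrow> q * p \<in> I" for p q using I.I_l_closed[of p q] by simp
  show "p \<in> I \<Longrightarrow> - p \<in> I" using mult[of p "- 1"] by (simp add: polys_uminus polys_one)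
qed

lemma finsum_eq_sum:
  assumes "abelian_monoid M" "add M = (+)" "zero M = (0 :: 'a::comm_monoid_add)"
    and "f \<in> A \<rightarrow> carrier M"
  shows "finsum M f A = sum f A"
proof -
  interpret abelian_monoid M by fact
  show ?thesis
    using assms(4)
  proof (induction A rule: infinite_finite_induct)
    case (insert x F)
    then show ?case by (subst finsum_insert) (auto simp: assms(2))
  qed (auto simp: assms(3) finsum_infinite)
qed

definition poly_proj :: "('v \<Rightarrow> int) \<Rightarrow> ('v, 'k::field) mpoly \<Rightarrow> ('v, 'k) mpoly" where
  "poly_proj a p = (\<Sum>u \<in> {u \<in> Poly_Mapping.keys p. mdeg u = a}.
     Poly_Mapping.single u (Poly_Mapping.lookup p u))"

lemma inj_mdeg: "mdeg u = mdeg u' \<Longrightarrow> u = u'"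
  by (auto simp: mdeg_def fun_eq_iff intro: poly_mapping_eqI)

lemma lookup_poly_proj:
  "Poly_Mapping.lookup (poly_proj a p) u = (if mdeg u = a then Poly_Mapping.lookup p u else 0)"
proof -
  have "Poly_Mapping.lookup (poly_proj a p) u =
    (\<Sum>u' \<in> {u \<in> Poly_Mapping.keys p. mdeg u = a}. if u' = u then Poly_Mapping.lookup p u else 0)"
    unfolding poly_proj_def lookup_sum by (intro sum.cong) (auto simp: lookup_single when_def)
  then show ?thesis
    by (auto simp: in_keys_iff)
qed

lemma keys_poly_proj:
  "Poly_Mapping.keys (poly_proj a p) = {u \<in> Poly_Mapping.keys p. mdeg u = a}"
  by (auto simp: in_keys_iff lookup_poly_proj split: if_splits)

lemma poly_proj_component: "p \<in> polys V \<Longrightarrow> poly_proj a p \<in> poly_component V a"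
  by (auto simp: poly_component_def polys_def keys_poly_proj)

lemma poly_proj_eq_0: "a \<notin> mdeg ` Poly_Mapping.keys p \<longleftrightarrow> poly_proj a p = 0"
  proof -
  have "poly_proj a p = 0 \<longleftrightarrow> Poly_Mapping.keys (poly_proj a p) = {}"
    by (simp add: poly_mapping_eq_iff fun_eq_iff in_keys_iff set_eq_iff)
  then show ?thesis
    unfolding keys_poly_proj by auto
qed

lemma poly_proj_add: "poly_proj a (p + q) = poly_proj a p + poly_proj a q"
  and poly_proj_minus: "poly_proj a (p - q) = poly_proj a p - poly_proj a q"
  and poly_proj_zero: "poly_proj a 0 = 0"
  by (rule poly_mapping_eqI; simp add: lookup_poly_proj lookup_add lookup_minus)+

lemma poly_proj_sum: "poly_proj a (sum f A) = (\<Sum>x\<in>A. poly_proj a (f x))"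
  by (induction A rule: infinite_finite_induct) (auto simp: poly_proj_add poly_proj_zero)

lemma poly_proj_of_component:
  assumes "p \<in> poly_component V b"
  shows "poly_proj a p = (if a = b then p else 0)"
proof (rule poly_mapping_eqI)
  fix u
  show "Poly_Mapping.lookup (poly_proj a p) u = Poly_Mapping.lookup (if a = b then p else 0) u"
    using assms
    by (cases "u \<in> Poly_Mapping.keys p") (auto simp: poly_component_def lookup_poly_proj in_keys_iff)
qed

lemma sum_poly_proj:
  assumes "finite A" "mdeg ` Poly_Mapping.keys p \<subseteq> A"
  shows "(\<Sum>a\<in>A. poly_proj a p) = p"
proof (rule poly_mapping_eqI)
  fix u
  have "Poly_Mapping.lookup (\<Sum>a\<in>A. poly_proj a p) u =
      (\<Sum>a\<in>A. if a = mdeg u then Poly_Mapping.lookup p u else 0)"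
    unfolding lookup_sum lookup_poly_proj by (intro sum.cong) auto
  also have "\<dots> = Poly_Mapping.lookup p u"
    using assms by (cases "u \<in> Poly_Mapping.keys p") (auto simp: in_keys_iff)
  finally show "Poly_Mapping.lookup (\<Sum>a\<in>A. poly_proj a p) u = Poly_Mapping.lookup p u" .
qed

lemma mdeg_keys_multidegrees: "p \<in> polys V \<Longrightarrow> mdeg ` Poly_Mapping.keys p \<subseteq> multidegrees V"
  by (force simp: polys_def multidegrees_def mdeg_def not_in_keys_iff_lookup_eq_zero[symmetric])

lemma poly_component_subset: "poly_component V a \<subseteq> polys V"
  by (auto simp: poly_component_def)

lemma poly_component_zero: "0 \<in> poly_component V a"
  and poly_component_add:
    "p \<in> poly_component V a \<Longrightarrow> q \<in> poly_component V a \<Longrightarrow> p + q \<in> poly_component V a"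
  and poly_component_uminus: "p \<in> poly_component V a \<Longrightarrow> - p \<in> poly_component V a"
  using Poly_Mapping.keys_add[of p q]
  by (auto simp: poly_component_def polys_zero polys_add polys_uminus in_keys_iff)

lemma poly_component_mult:
  assumes "p \<in> poly_component V a" "q \<in> poly_component V b"
  shows "p * q \<in> poly_component V (\<lambda>v. a v + b v)"
proof -
  have "mdeg u = (\<lambda>v. a v + b v)" if "u \<in> Poly_Mapping.keys (p * q)" for u
  proof -
    from that keys_mult[of p q] obtain s t
      where u: "u = s + t" and st: "s \<in> Poly_Mapping.keys p" "t \<in> Poly_Mapping.keys q"
      by blast
    then have "mdeg s = a" "mdeg t = b"
      using assms by (auto simp: poly_component_def)
    then show ?thesis
      by (auto simp: u mdeg_def lookup_add fun_eq_iff)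
  qed
  then show ?thesis
    using assms by (auto simp: poly_component_def polys_mult)
qed

definition monomial_ideal :: "'v set \<Rightarrow> ('v, 'k::field) mpoly set \<Rightarrow> bool" where
  "monomial_ideal V I \<longleftrightarrow> ideal I (poly_ring V) \<and>
     (\<forall>p \<in> I. \<forall>u \<in> Poly_Mapping.keys p. Poly_Mapping.single u 1 \<in> I)"

lemma monomial_ideal_closed:
  assumes "monomial_ideal V I"
  shows "I \<subseteq> polys V" "0 \<in> I" "p \<in> I \<Longrightarrow> q \<in> I \<Longrightarrow> p + q \<in> I" "p \<in> I \<Longrightarrow> - p \<in> I"
    "p \<in> I \<Longrightarrow> q \<in> polys V \<Longrightarrow> q * p \<in> I"
  using assms unfolding monomial_ideal_def by (blast dest: ideal_poly_ring_closed)+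

lemma monomial_ideal_sum: "monomial_ideal V I \<Longrightarrow> (\<And>x. x \<in> A \<Longrightarrow> f x \<in> I) \<Longrightarrow> sum f A \<in> I"
  by (induction A rule: infinite_finite_induct) (auto simp: monomial_ideal_closed)

lemma monomial_ideal_proj:
  assumes "monomial_ideal V I" "p \<in> I"
  shows "poly_proj a p \<in> I"
  unfolding poly_proj_def
proof (rule monomial_ideal_sum[OF assms(1)])
  fix u assume u: "u \<in> {u \<in> Poly_Mapping.keys p. mdeg u = a}"
  then have "Poly_Mapping.single u 1 \<in> I"
    using assms by (auto simp: monomial_ideal_def)
  then have "Poly_Mapping.single 0 (Poly_Mapping.lookup p u) * Poly_Mapping.single u 1 \<in> I"
    using assms(1) by (intro monomial_ideal_closed) (auto simp: polys_single)
  then show "Poly_Mapping.single u (Poly_Mapping.lookup p u) \<in> I"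
    by (simp add: mult_single)
qed

definition monomial_span :: "'v set \<Rightarrow> ('v \<Rightarrow>\<^sub>0 nat) set \<Rightarrow> ('v, 'k::field) mpoly set" where
  "monomial_span V B = {p \<in> polys V. \<forall>u \<in> Poly_Mapping.keys p. \<exists>b \<in> B. \<exists>t. u = t + b}"

lemma ideal_monomial_span: "ideal (monomial_span V B :: ('v, 'k::field) mpoly set) (poly_ring V)"
proof (rule idealI)
  interpret R: cring "poly_ring V :: ('v, 'k) mpoly ring" by (rule cring_poly_ring)
  show "ring (poly_ring V :: ('v, 'k) mpoly ring)" by (rule R.ring_axioms)
  show "subgroup (monomial_span V B) (add_monoid (poly_ring V :: ('v, 'k) mpoly ring))"
  proof (rule R.add.subgroupI)
    fix p q :: "('v, 'k) mpoly"
    assume p: "p \<in> monomial_span V B"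
    then show "\<ominus>\<^bsub>poly_ring V\<^esub> p \<in> monomial_span V B"
      by (subst a_inv_poly_ring) (auto simp: monomial_span_def polys_uminus in_keys_iff)
    assume "q \<in> monomial_span V B"
    with p show "p \<oplus>\<^bsub>poly_ring V\<^esub> q \<in> monomial_span V B"
      using Poly_Mapping.keys_add[of p q] by (auto simp: monomial_span_def polys_add)
  next
    show "monomial_span V B \<noteq> ({} :: ('v, 'k) mpoly set)"
      using polys_zero by (force simp: monomial_span_def)
  qed (auto simp: monomial_span_def)
next
  fix p x :: "('v, 'k) mpoly"
  assume p: "p \<in> monomial_span V B" and x: "x \<in> carrier (poly_ring V)"
  have "\<exists>b \<in> B. \<exists>t. u = t + b" if "u \<in> Poly_Mapping.keys (x * p)" for u
  proof -
    from that keys_mult[of x p] obtain s w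
      where u: "u = s + w" and w: "w \<in> Poly_Mapping.keys p"
      by blast
    then obtain b t where "b \<in> B" "w = t + b"
      using p by (auto simp: monomial_span_def)
    then show ?thesis
      using u by (metis add.assoc)
  qed
  with p x show "x \<otimes>\<^bsub>poly_ring V\<^esub> p \<in> monomial_span V B"
    by (auto simp: monomial_span_def polys_mult)
  then show "p \<otimes>\<^bsub>poly_ring V\<^esub> x \<in> monomial_span V B"
    by (simp add: mult.commute)
qed

lemma monomial_span_repr:
  fixes p :: "('v, 'k::field) mpoly"
  assumes p: "p \<in> monomial_span V B" and "finite B"
  shows "\<exists>c \<in> B \<rightarrow> polys V. p = (\<Sum>b \<in> B. c b * Poly_Mapping.single b 1)"
proof -
  have "\<forall>u \<in> Poly_Mapping.keys p. \<exists>b. b \<in> B \<and> (\<exists>t. u = t + b)"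
    using p unfolding monomial_span_def by blast
  from bchoice[OF this] obtain \<beta>
    where b: "\<forall>u \<in> Poly_Mapping.keys p. \<beta> u \<in> B \<and> (\<exists>t. u = t + \<beta> u)" ..
  then have "\<forall>u \<in> Poly_Mapping.keys p. \<exists>t. u = t + \<beta> u" by blast
  from bchoice[OF this] obtain \<tau> where "\<forall>u \<in> Poly_Mapping.keys p. u = \<tau> u + \<beta> u" ..
  with b have bt: "\<beta> u \<in> B \<and> u = \<tau> u + \<beta> u" if "u \<in> Poly_Mapping.keys p" for u
    using that by blast
  define c :: "_ \<Rightarrow> ('v, 'k) mpoly" where "c b = (\<Sum>u \<in> {u \<in> Poly_Mapping.keys p. \<beta> u = b}.
    Poly_Mapping.single (\<tau> u) (Poly_Mapping.lookup p u))" for b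
  have "Poly_Mapping.single (\<tau> u) (Poly_Mapping.lookup p u) \<in> polys V"
    if u: "u \<in> Poly_Mapping.keys p" for u
  proof (rule polys_single)
    have "Poly_Mapping.keys (\<tau> u) \<subseteq> Poly_Mapping.keys u"
    proof
      fix v assume "v \<in> Poly_Mapping.keys (\<tau> u)"
      moreover have "Poly_Mapping.lookup u v =
          Poly_Mapping.lookup (\<tau> u) v + Poly_Mapping.lookup (\<beta> u) v"
        using arg_cong[OF conjunct2[OF bt[OF u]], of "\<lambda>w. Poly_Mapping.lookup w v"]
        by (simp only: lookup_add)
      ultimately show "v \<in> Poly_Mapping.keys u"
        by (simp add: in_keys_iff)
    qed
    then show "Poly_Mapping.keys (\<tau> u) \<subseteq> V"
      using p u by (auto simp: monomial_span_def polys_def)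
  qed
  then have "c \<in> B \<rightarrow> polys V"
    by (auto simp: c_def intro!: polys_sum)
  moreover have "(\<Sum>b \<in> B. c b * Poly_Mapping.single b 1) = p"
  proof -
    have "(\<Sum>b \<in> B. c b * Poly_Mapping.single b 1) =
       (\<Sum>b \<in> B. \<Sum>u \<in> {u \<in> Poly_Mapping.keys p. \<beta> u = b}.
          Poly_Mapping.single u (Poly_Mapping.lookup p u))"
      unfolding c_def sum_distrib_right
      by (intro sum.cong refl) (auto simp: mult_single conjunct2[OF bt, symmetric])
    also have "\<dots> = (\<Sum>u \<in> Poly_Mapping.keys p. Poly_Mapping.single u (Poly_Mapping.lookup p u))"
      by (rule sum.group) (simp_all add: \<open>finite B\<close> image_subset_iff conjunct1[OF bt])
    also have "\<dots> = p"
      by (rule poly_mapping_eqI) (auto simp: lookup_sum lookup_single when_def in_keys_iff)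
    finally show ?thesis .
  qed
  ultimately show ?thesis by (intro bexI[of _ c]) (rule sym)
qed

lemma monomial_span_eq_genideal:
  assumes "finite B" "\<And>b. b \<in> B \<Longrightarrow> Poly_Mapping.keys b \<subseteq> V"
  shows "Idl\<^bsub>poly_ring V\<^esub> ((\<lambda>b. Poly_Mapping.single b 1) ` B) =
    (monomial_span V B :: ('v, 'k::field) mpoly set)" (is "?I = ?S")
proof
  interpret R: cring "poly_ring V :: ('v, 'k) mpoly ring" by (rule cring_poly_ring)
  have sub: "(\<lambda>b. Poly_Mapping.single b 1) ` B \<subseteq> (polys V :: ('v, 'k) mpoly set)"
    using assms by (auto intro: polys_single)
  show "?I \<subseteq> ?S"
    by (rule R.genideal_minimal[OF ideal_monomial_span])
      (use sub in \<open>auto simp: monomial_span_def intro!: bexI exI[of _ 0]\<close>)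
  have cl: "ideal ?I (poly_ring V)" using sub by (intro R.genideal_ideal) simp
  show "?S \<subseteq> ?I"
  proof
    fix p assume "p \<in> ?S"
    then obtain c where c: "c \<in> B \<rightarrow> polys V" and p: "p = (\<Sum>b \<in> B. c b * Poly_Mapping.single b 1)"
      using monomial_span_repr[OF _ assms(1)] by blast
    have "c b * Poly_Mapping.single b 1 \<in> ?I" if "b \<in> B" for b
    proof -
      have "Poly_Mapping.single b 1 \<in> ?I"
        using subsetD[OF R.genideal_self[of "(\<lambda>b. Poly_Mapping.single b 1) ` B"]] sub that by simp
      moreover have "c b \<in> polys V"
        using c that by (rule funcset_mem)
      ultimately show ?thesis
        by (rule ideal_poly_ring_closed(5)[OF cl])
    qed
    then have "(\<Sum>b \<in> X. c b * Poly_Mapping.single b 1) \<in> ?I" if "X \<subseteq> B" for X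
      using that
      by (induction X rule: infinite_finite_induct)
        (simp_all add: ideal_poly_ring_closed(2,3)[OF cl])
    then show "p \<in> ?I" unfolding p by blast
  qed
qed

lemma edge_ideal_eq_monomial_span:
  assumes "simple_graph G"
  shows "edge_ideal G = (monomial_span (verts G)
      {Poly_Mapping.single u 1 + Poly_Mapping.single v 1 | u v. {u, v} \<in> edges G}
      :: ('v, 'k::field) mpoly set)"
    and "finite {Poly_Mapping.single u (1::nat) + Poly_Mapping.single v 1 | u v. {u, v} \<in> edges G}"
    and "\<And>b. b \<in> {Poly_Mapping.single u (1::nat) + Poly_Mapping.single v 1 | u v. {u, v} \<in> edges G}
      \<Longrightarrow> Poly_Mapping.keys b \<subseteq> verts G"
proof -
  let ?B = "{Poly_Mapping.single u (1::nat) + Poly_Mapping.single v 1 | u v. {u, v} \<in> edges G}"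
  have uv: "u \<in> verts G \<and> v \<in> verts G" if "{u, v} \<in> edges G" for u v
    using that assms unfolding simple_graph_def by blast
  have "?B \<subseteq> (\<lambda>(u, v). Poly_Mapping.single u 1 + Poly_Mapping.single v 1) ` (verts G \<times> verts G)"
    using uv by auto
  then show fin: "finite ?B"
    by (rule finite_subset) (use assms in \<open>auto simp: simple_graph_def\<close>)
  show keys: "Poly_Mapping.keys b \<subseteq> verts G" if "b \<in> ?B" for b
    using that uv by (auto simp: in_keys_iff lookup_add lookup_single when_def split: if_splits)
  have "{var u * var v | u v. {u, v} \<in> edges G} =
      ((\<lambda>b. Poly_Mapping.single b 1) ` ?B :: ('v, 'k) mpoly set)"
    by (auto simp: var_def mult_single image_iff) metis?
  then show "edge_ideal G = (monomial_span (verts G) ?B :: ('v, 'k) mpoly set)"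
    unfolding edge_ideal_def using monomial_span_eq_genideal[OF fin keys] by simp
qed

lemma monomial_ideal_monomial_span:
  "monomial_ideal V (monomial_span V B :: ('v, 'k::field) mpoly set)"
  using ideal_monomial_span unfolding monomial_ideal_def
  by (auto simp: monomial_span_def polys_def)

lemma monomial_ideal_edge_ideal:
  "simple_graph G \<Longrightarrow> monomial_ideal (verts G) (edge_ideal G :: ('v, 'k::field) mpoly set)"
  by (simp add: edge_ideal_eq_monomial_span(1) monomial_ideal_monomial_span)

lemma module_ideal_module:
  assumes "ideal I (poly_ring V)"
  shows "module (poly_ring V) (ideal_module (poly_ring V) (I :: ('v, 'k::field) mpoly set))"
proof (rule moduleI)
  note cl = ideal_poly_ring_closed[OF assms]
  show "cring (poly_ring V :: ('v, 'k) mpoly ring)" by (rule cring_poly_ring)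
  show "abelian_group (ideal_module (poly_ring V) I)"
  proof (rule abelian_groupI)
    fix x assume "x \<in> carrier (ideal_module (poly_ring V) I)"
    then have "- x \<in> I" by (simp add: ideal_module_def cl)
    then show "\<exists>y\<in>carrier (ideal_module (poly_ring V) I).
        y \<oplus>\<^bsub>ideal_module (poly_ring V) I\<^esub> x = \<zero>\<^bsub>ideal_module (poly_ring V) I\<^esub>"
      by (auto simp: ideal_module_def intro!: bexI[of _ "- x"])
  qed (simp_all add: ideal_module_def cl add_ac)
qed (simp_all add: ideal_module_def ideal_poly_ring_closed[OF assms] distrib_left distrib_right mult.assoc)

lemma direct_sum_ideal:
  assumes "monomial_ideal V (I :: ('v, 'k::field) mpoly set)"
  shows "direct_sum (ideal_module (poly_ring V) I) (multidegrees V) (ideal_component V I)"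
    (is "direct_sum ?M ?D ?gr")
proof -
  note cl = monomial_ideal_closed[OF assms]
  interpret module "poly_ring V" ?M
    using assms by (intro module_ideal_module) (simp add: monomial_ideal_def)
  have [simp]: "carrier ?M = I" "zero ?M = 0" "add ?M = (+)"
    by (simp_all add: ideal_module_def)
  have inv: "\<ominus>\<^bsub>?M\<^esub> x = - x" if "x \<in> I" for x
    using that by (intro M.minus_equality) (auto simp: cl)
  have fs: "finsum ?M f A = sum f A" if "f \<in> A \<rightarrow> I" for f and A :: "('v \<Rightarrow> int) set"
    using that by (intro finsum_eq_sum M.abelian_monoid_axioms) auto
  show ?thesis
    unfolding direct_sum_def
  proof (intro conjI ballI)
    fix a
    show "additive_subgroup (?gr a) ?M"
    proof (rule additive_subgroupI[OF M.abelian_group_axioms])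
      show "?gr a \<noteq> {}"
        using cl(2) poly_component_zero by (auto simp: ideal_component_def)
    qed (auto simp: ideal_component_def cl inv poly_component_add poly_component_uminus)
  next
    fix x assume "x \<in> carrier ?M"
    then have x: "x \<in> I" "x \<in> polys V" using cl(1) by auto
    define h where "h = (\<lambda>a \<in> ?D. poly_proj a x)"
    have supp: "{a \<in> ?D. h a \<noteq> \<zero>\<^bsub>?M\<^esub>} = mdeg ` Poly_Mapping.keys x"
      using mdeg_keys_multidegrees[OF x(2)] poly_proj_eq_0[of _ x] by (auto simp: h_def)
    show "\<exists>!f. f \<in> Pi\<^sub>E ?D ?gr \<and> finite {i \<in> ?D. f i \<noteq> \<zero>\<^bsub>?M\<^esub>} \<and>
        x = (\<Oplus>\<^bsub>?M\<^esub>i \<in> {i \<in> ?D. f i \<noteq> \<zero>\<^bsub>?M\<^esub>}. f i)"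
    proof (rule ex1I[of _ h], intro conjI)
      show "h \<in> Pi\<^sub>E ?D ?gr"
        using x assms by (auto simp: h_def ideal_component_def monomial_ideal_proj poly_proj_component)
      show "finite {i \<in> ?D. h i \<noteq> \<zero>\<^bsub>?M\<^esub>}"
        unfolding supp by simp
      have "finsum ?M h (mdeg ` Poly_Mapping.keys x) = sum h (mdeg ` Poly_Mapping.keys x)"
        using x assms mdeg_keys_multidegrees[OF x(2)]
        by (intro fs) (auto simp: h_def monomial_ideal_proj)
      also have "\<dots> = (\<Sum>a \<in> mdeg ` Poly_Mapping.keys x. poly_proj a x)"
        using mdeg_keys_multidegrees[OF x(2)] by (intro sum.cong) (auto simp: h_def)
      also have "\<dots> = x" by (rule sum_poly_proj) auto
      finally show "x = (\<Oplus>\<^bsub>?M\<^esub>i \<in> {i \<in> ?D. h i \<noteq> \<zero>\<^bsub>?M\<^esub>}. h i)"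
        unfolding supp by simp
    next
      fix f
      let ?S = "{i \<in> ?D. f i \<noteq> \<zero>\<^bsub>?M\<^esub>}"
      assume f: "f \<in> Pi\<^sub>E ?D ?gr \<and> finite ?S \<and> x = finsum ?M f ?S"
      then have fc: "f a \<in> poly_component V a" "f a \<in> I" if "a \<in> ?D" for a
        using that by (auto simp: ideal_component_def PiE_iff)
      have x: "x = sum f ?S"
        using f fc by (subst fs[symmetric]) auto
      have "f a = poly_proj a x" if "a \<in> ?D" for a
      proof -
        have "poly_proj a x = (\<Sum>b \<in> ?S. if b = a then f a else 0)"
          unfolding x poly_proj_sum
          by (intro sum.cong refl) (use poly_proj_of_component[OF fc(1)] in auto)
        also have "\<dots> = f a"
          using f that by (auto simp: sum.delta)
        finally show ?thesis by simp
      qed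
      then show "f = h"
        using f by (intro ext) (auto simp: h_def PiE_iff extensional_def)
    qed
  qed
qed

lemma multigraded_ideal_monomial_span:
  assumes "finite V" "finite B" "\<And>b. b \<in> B \<Longrightarrow> Poly_Mapping.keys b \<subseteq> V"
  defines "I \<equiv> monomial_span V B :: ('v, 'k::field) mpoly set"
  shows "multigraded_module V (ideal_module (poly_ring V) I) (ideal_component V I)"
proof (rule multigraded_module.intro)
  have mono: "monomial_ideal V I"
    unfolding I_def by (rule monomial_ideal_monomial_span)
  note cl = monomial_ideal_closed[OF mono]
  let ?M = "ideal_module (poly_ring V) I"
  have [simp]: "carrier ?M = I" "zero ?M = 0" "add ?M = (+)" "smult ?M = (*)"
    by (simp_all add: ideal_module_def)
  show mod: "module (poly_ring V) ?M"
    using mono by (intro module_ideal_module) (simp add: monomial_ideal_def)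
  interpret module "poly_ring V" ?M by (rule mod)
  show "finite V" by fact
  show "direct_sum ?M (multidegrees V) (ideal_component V I)"
    by (rule direct_sum_ideal[OF mono])
  show "p \<odot>\<^bsub>?M\<^esub> x \<in> ideal_component V I (\<lambda>v. a v + b v)"
    if "a \<in> multidegrees V" "b \<in> multidegrees V" and that: "p \<in> poly_component V a" "x \<in> ideal_component V I b" for a b p x
    using poly_component_mult[OF that(1)] subsetD[OF poly_component_subset that(1)] that(2)
    by (simp add: ideal_component_def cl)
  let ?s = "\<lambda>b. Poly_Mapping.single b 1 :: ('v, 'k) mpoly"
  have sI: "?s b \<in> I" if "b \<in> B" for b
    using that assms(3)[OF that] by (auto simp: I_def monomial_span_def polys_single intro!: bexI exI[of _ 0])
  have inj: "inj_on ?s B"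
    by (auto simp: inj_on_def) (metis keys_single singleton_inject zero_neq_one)
  show "\<exists>F. finite F \<and> F \<subseteq> carrier ?M \<and>
      (\<forall>x \<in> carrier ?M. \<exists>c \<in> F \<rightarrow> polys V. x = (\<Oplus>\<^bsub>?M\<^esub>f \<in> F. c f \<odot>\<^bsub>?M\<^esub> f))"
  proof (intro exI[of _ "?s ` B"] conjI ballI)
    fix x assume "x \<in> carrier ?M"
    then have "x \<in> monomial_span V B" by (simp add: I_def ideal_module_def)
    then obtain c where c: "c \<in> B \<rightarrow> polys V" and x: "x = (\<Sum>b \<in> B. c b * ?s b)"
      using monomial_span_repr[OF _ assms(2)] by blast
    define d where "d f = c (the_inv_into B ?s f)" for f
    have d: "d (?s b) = c b" if "b \<in> B" for b
      using the_inv_into_f_f[OF inj that] by (simp add: d_def)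
    have dc: "d \<in> ?s ` B \<rightarrow> polys V"
      using d c by auto
    have "(\<Oplus>\<^bsub>?M\<^esub>f \<in> ?s ` B. d f \<odot>\<^bsub>?M\<^esub> f) = (\<Sum>f \<in> ?s ` B. d f * f)"
      by (subst finsum_eq_sum[OF M.abelian_monoid_axioms]) (auto intro!: cl(5) sI funcset_mem[OF dc])
    also have "\<dots> = x"
      unfolding x sum.reindex[OF inj] by (intro sum.cong) (auto simp: d)
    finally show "\<exists>c \<in> ?s ` B \<rightarrow> polys V. x = (\<Oplus>\<^bsub>?M\<^esub>f \<in> ?s ` B. c f \<odot>\<^bsub>?M\<^esub> f)"
      by (intro bexI[OF _ dc]) (rule sym)
  qed (use assms(2) sI in \<open>auto simp: ideal_module_def\<close>)
qed

lemma multigraded_edge_ideal: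
  assumes "simple_graph G"
  shows "multigraded_module (verts G)
    (ideal_module (poly_ring (verts G)) (edge_ideal G :: ('v, 'k::field) mpoly set))
    (ideal_component (verts G) (edge_ideal G))"
  unfolding edge_ideal_eq_monomial_span(1)[OF assms]
  using assms edge_ideal_eq_monomial_span(2,3)[OF assms]
  by (intro multigraded_ideal_monomial_span) (auto simp: simple_graph_def)

lemma quotient_module_ops:
  fixes I :: "('v, 'k::field) mpoly set"
  assumes "ideal I (poly_ring V)"
  defines "M \<equiv> quotient_module (poly_ring V) I" and "c \<equiv> \<lambda>p. I +>\<^bsub>poly_ring V\<^esub> p"
  shows "carrier M = c ` polys V" "zero M = c 0"
    "p \<in> polys V \<Longrightarrow> q \<in> polys V \<Longrightarrow> c p \<oplus>\<^bsub>M\<^esub> c q = c (p + q)"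
    "p \<in> polys V \<Longrightarrow> q \<in> polys V \<Longrightarrow> p \<odot>\<^bsub>M\<^esub> c q = c (p * q)"
    "p \<in> polys V \<Longrightarrow> q \<in> polys V \<Longrightarrow> c p = c q \<longleftrightarrow> p - q \<in> I"
proof -
  interpret ideal I "poly_ring V" by fact
  show "carrier M = c ` polys V"
    by (auto simp: M_def c_def quotient_module_def FactRing_def A_RCOSETS_def')
  show "zero M = c 0"
    using a_coset_add_zero[OF a_subset] by (simp add: M_def c_def quotient_module_def FactRing_def)
  show "p \<in> polys V \<Longrightarrow> q \<in> polys V \<Longrightarrow> c p \<oplus>\<^bsub>M\<^esub> c q = c (p + q)"
    using a_rcos_sum[of p q] by (simp add: M_def c_def quotient_module_def FactRing_def)
  show "p \<in> polys V \<Longrightarrow> q \<in> polys V \<Longrightarrow> p \<odot>\<^bsub>M\<^esub> c q = c (p * q)"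
    using rcoset_mult_add[of p q] by (simp add: M_def c_def quotient_module_def FactRing_def)
  show "c p = c q \<longleftrightarrow> p - q \<in> I" if "p \<in> polys V" "q \<in> polys V"
    using quotient_eq_iff_same_a_r_cos[of I p q] that assms(1)
    by (simp add: c_def a_minus_def a_inv_poly_ring)
qed

lemma module_quotient_module:
  assumes "ideal I (poly_ring V)"
  shows "module (poly_ring V) (quotient_module (poly_ring V) (I :: ('v, 'k::field) mpoly set))"
proof -
  let ?M = "quotient_module (poly_ring V) I"
  note ops = quotient_module_ops[OF assms]
  show ?thesis
  proof (rule moduleI)
    show "abelian_group ?M"
    proof (rule abelian_groupI)
      fix x assume "x \<in> carrier ?M"
      then obtain p where p: "p \<in> polys V" "x = I +>\<^bsub>poly_ring V\<^esub> p" by (auto simp: ops(1))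
      then show "\<exists>y \<in> carrier ?M. y \<oplus>\<^bsub>?M\<^esub> x = \<zero>\<^bsub>?M\<^esub>"
        by (intro bexI[of _ "I +>\<^bsub>poly_ring V\<^esub> (- p)"]) (auto simp: ops polys_uminus)
    qed (auto simp: ops(1-4) polys_add polys_zero add_ac)
    show "cring (poly_ring V :: ('v, 'k) mpoly ring)" by (rule cring_poly_ring)
  qed (auto simp: ops(1-4) polys_add polys_mult polys_one algebra_simps)
qed

lemma finsum_quotient:
  assumes "ideal I (poly_ring V)" "f \<in> A \<rightarrow> polys V"
  shows "finsum (quotient_module (poly_ring V) I) (\<lambda>x. I +>\<^bsub>poly_ring V\<^esub> f x) A
    = I +>\<^bsub>poly_ring V\<^esub> (sum f A :: ('v, 'k::field) mpoly)"
proof -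
  let ?M = "quotient_module (poly_ring V) I"
  note ops = quotient_module_ops[OF assms(1)]
  interpret module "poly_ring V" ?M by (rule module_quotient_module[OF assms(1)])
  show ?thesis
    using assms(2)
  proof (induction A rule: infinite_finite_induct)
    case (insert x F)
    moreover have "sum f F \<in> polys V"
      using insert by (intro polys_sum) auto
    ultimately show ?case
      by (subst M.finsum_insert) (auto simp: ops)
  qed (auto simp: ops M.finsum_infinite)
qed

lemma direct_sum_quotient:
  assumes "monomial_ideal V (I :: ('v, 'k::field) mpoly set)"
  shows "direct_sum (quotient_module (poly_ring V) I) (multidegrees V) (quotient_component V I)"
    (is "direct_sum ?M ?D ?gr")
proof -
  note cl = monomial_ideal_closed[OF assms]
  have I: "ideal I (poly_ring V)" using assms by (simp add: monomial_ideal_def)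
  note ops = quotient_module_ops[OF I]
  let ?c = "\<lambda>p. I +>\<^bsub>poly_ring V\<^esub> p"
  interpret module "poly_ring V" ?M by (rule module_quotient_module[OF I])
  have inv: "\<ominus>\<^bsub>?M\<^esub> ?c p = ?c (- p)" if "p \<in> polys V" for p
    using that by (intro M.minus_equality) (auto simp: ops polys_uminus)
  have pc: "p \<in> polys V" if "p \<in> poly_component V a" for p :: "('v, 'k) mpoly" and a
    using that poly_component_subset by blast
  show ?thesis
    unfolding direct_sum_def
  proof (intro conjI ballI)
    fix a
    show "additive_subgroup (?gr a) ?M"
    proof (rule additive_subgroupI[OF M.abelian_group_axioms])
      show "?gr a \<subseteq> carrier ?M"
        using pc by (auto simp: quotient_component_def ops(1))
      show "?gr a \<noteq> {}"
        using poly_component_zero by (auto simp: quotient_component_def)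
    next
      fix x y assume "x \<in> ?gr a"
      then obtain p where p: "p \<in> poly_component V a" "x = ?c p"
        by (auto simp: quotient_component_def)
      then show "\<ominus>\<^bsub>?M\<^esub> x \<in> ?gr a"
        using inv[OF pc[OF p(1)]] poly_component_uminus[OF p(1)]
        by (simp add: quotient_component_def)
      assume "y \<in> ?gr a"
      then obtain q where q: "q \<in> poly_component V a" "y = ?c q"
        by (auto simp: quotient_component_def)
      have "x \<oplus>\<^bsub>?M\<^esub> y = ?c (p + q)"
        using p q pc by (simp add: ops(3))
      then show "x \<oplus>\<^bsub>?M\<^esub> y \<in> ?gr a"
        using poly_component_add[OF p(1) q(1)] by (auto simp: quotient_component_def)
    qed
  next
    fix x assume "x \<in> carrier ?M"
    then obtain p where p: "p \<in> polys V" and x: "x = ?c p" by (auto simp: ops(1))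
    define h where "h = (\<lambda>a \<in> ?D. ?c (poly_proj a p))"
    let ?K = "mdeg ` Poly_Mapping.keys p" and ?H = "{a \<in> ?D. h a \<noteq> \<zero>\<^bsub>?M\<^esub>}"
    have K: "?K \<subseteq> ?D" by (rule mdeg_keys_multidegrees[OF p])
    have pp: "poly_proj a p \<in> polys V" for a
      using pc[OF poly_proj_component[OF p]] .
    have supp: "?H \<subseteq> ?K"
      using poly_proj_eq_0[of _ p] by (auto simp: h_def ops(2))
    show "\<exists>!f. f \<in> Pi\<^sub>E ?D ?gr \<and> finite {i \<in> ?D. f i \<noteq> \<zero>\<^bsub>?M\<^esub>} \<and>
        x = (\<Oplus>\<^bsub>?M\<^esub>i \<in> {i \<in> ?D. f i \<noteq> \<zero>\<^bsub>?M\<^esub>}. f i)"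
    proof (rule ex1I[of _ h], intro conjI)
      show "h \<in> Pi\<^sub>E ?D ?gr"
        using poly_proj_component[OF p] by (simp add: h_def quotient_component_def)
      show "finite ?H"
        using supp by (rule finite_subset) simp
      have "finsum ?M h ?H = finsum ?M h ?K"
        by (rule M.add.finprod_mono_neutral_cong_left)
          (use supp K pp in \<open>auto simp: h_def ops(1)\<close>)
      also have "\<dots> = finsum ?M (\<lambda>a. ?c (poly_proj a p)) ?K"
        by (rule M.finsum_cong') (use K pp in \<open>auto simp: h_def ops(1)\<close>)
      also have "\<dots> = ?c (\<Sum>a \<in> ?K. poly_proj a p)"
        by (rule finsum_quotient[OF I]) (use pp in auto)
      also have "\<dots> = x" unfolding x by (subst sum_poly_proj) auto
      finally show "x = (\<Oplus>\<^bsub>?M\<^esub>i \<in> ?H. h i)" by simp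
    next
      fix f
      let ?S = "{i \<in> ?D. f i \<noteq> \<zero>\<^bsub>?M\<^esub>}"
      assume f: "f \<in> Pi\<^sub>E ?D ?gr \<and> finite ?S \<and> x = finsum ?M f ?S"
      then have "\<forall>a \<in> ?D. \<exists>q. q \<in> poly_component V a \<and> f a = ?c q"
        by (auto simp: PiE_iff quotient_component_def)
      then obtain q where q: "\<And>a. a \<in> ?D \<Longrightarrow> q a \<in> poly_component V a \<and> f a = ?c (q a)"
        by metis
      have qp: "q a \<in> polys V" if "a \<in> ?D" for a using q[OF that] pc by blast
      have "x = finsum ?M (\<lambda>a. ?c (q a)) ?S"
        using f q qp by (subst M.finsum_cong'[of ?S ?S f "\<lambda>a. ?c (q a)"]) (auto simp: ops(1))
      also have "\<dots> = ?c (sum q ?S)"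
        by (rule finsum_quotient[OF I]) (use qp in auto)
      finally have "sum q ?S - p \<in> I"
        using x p qp by (subst ops(5)[symmetric]) (auto intro: polys_sum)
      then have d: "poly_proj a (sum q ?S - p) \<in> I" for a
        by (rule monomial_ideal_proj[OF assms])
      have "f a = ?c (poly_proj a p)" if a: "a \<in> ?D" for a
      proof -
        have "poly_proj a (sum q ?S) = (\<Sum>b \<in> ?S. if b = a then q a else 0)"
          unfolding poly_proj_sum
          by (intro sum.cong refl) (use poly_proj_of_component[OF conjunct1[OF q]] in auto)
        also have "\<dots> = (if a \<in> ?S then q a else 0)"
          using f by (auto simp: sum.delta)
        finally have e: "(if a \<in> ?S then q a else 0) - poly_proj a p \<in> I"
          using d[of a] by (simp add: poly_proj_minus)
        have "f a = ?c (if a \<in> ?S then q a else 0)"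
          using q[OF a] a by (auto simp: ops(2))
        also have "\<dots> = ?c (poly_proj a p)"
          using e pp qp[OF a] by (subst ops(5)) (auto simp: polys_zero)
        finally show ?thesis .
      qed
      then show "f = h"
        using f by (intro ext) (auto simp: h_def PiE_iff extensional_def)
    qed
  qed
qed

lemma multigraded_quotient:
  assumes "finite V" "monomial_ideal V (I :: ('v, 'k::field) mpoly set)"
  shows "multigraded_module V (quotient_module (poly_ring V) I) (quotient_component V I)"
proof (rule multigraded_module.intro)
  have I: "ideal I (poly_ring V)" using assms by (simp add: monomial_ideal_def)
  let ?M = "quotient_module (poly_ring V) I"
  let ?c = "\<lambda>p. I +>\<^bsub>poly_ring V\<^esub> p"
  note ops = quotient_module_ops[OF I]
  show mod: "module (poly_ring V) ?M" by (rule module_quotient_module[OF I])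
  interpret module "poly_ring V" ?M by (rule mod)
  show "finite V" by fact
  show "direct_sum ?M (multidegrees V) (quotient_component V I)"
    by (rule direct_sum_quotient[OF assms(2)])
  show "p \<odot>\<^bsub>?M\<^esub> x \<in> quotient_component V I (\<lambda>v. a v + b v)"
    if "a \<in> multidegrees V" "b \<in> multidegrees V" and that: "p \<in> poly_component V a" "x \<in> quotient_component V I b" for a b p x
  proof -
    from that(2) obtain q where q: "q \<in> poly_component V b" "x = ?c q"
      by (auto simp: quotient_component_def)
    then have "p \<odot>\<^bsub>?M\<^esub> x = ?c (p * q)"
      using ops(4)[OF subsetD[OF poly_component_subset that(1)] subsetD[OF poly_component_subset q(1)]]
      by simp
    then show ?thesis
      using poly_component_mult[OF that(1) q(1)] by (auto simp: quotient_component_def)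
  qed
  show "\<exists>F. finite F \<and> F \<subseteq> carrier ?M \<and>
      (\<forall>x \<in> carrier ?M. \<exists>c \<in> F \<rightarrow> polys V. x = (\<Oplus>\<^bsub>?M\<^esub>f \<in> F. c f \<odot>\<^bsub>?M\<^esub> f))"
  proof (intro exI[of _ "{?c 1}"] conjI ballI)
    fix x assume "x \<in> carrier ?M"
    then obtain p where p: "p \<in> polys V" "x = ?c p" by (auto simp: ops(1))
    have "(\<Oplus>\<^bsub>?M\<^esub>f \<in> {?c 1}. p \<odot>\<^bsub>?M\<^esub> f) = x"
      using p ops(3)[OF p(1) polys_zero]
      by (subst M.finsum_insert) (auto simp: ops(1,2,4) polys_one polys_zero)
    with p show "\<exists>c \<in> {?c 1} \<rightarrow> polys V. x = (\<Oplus>\<^bsub>?M\<^esub>f \<in> {?c 1}. c f \<odot>\<^bsub>?M\<^esub> f)"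
      by (intro bexI[of _ "\<lambda>_. p"]) auto
  qed (auto simp: ops(1) polys_one)
qed

lemma multigraded_edge_quotient:
  assumes "simple_graph G"
  shows "multigraded_module (verts G)
    (quotient_module (poly_ring (verts G)) (edge_ideal G :: ('v, 'k::field) mpoly set))
    (quotient_component (verts G) (edge_ideal G))"
  using assms monomial_ideal_edge_ideal[OF assms]
  by (intro multigraded_quotient) (auto simp: simple_graph_def)

lemma (in multigraded_module) additive_subgroup_stanley_space:
  assumes "A \<subseteq> V" "w \<in> carrier M"
  shows "additive_subgroup (stanley_space M w A) M"
proof -
  interpret module "poly_ring V" M by (rule is_module)
  have A: "p \<in> polys V" if "p \<in> polys A" for p :: "('v, 'k) mpoly"
    using that assms by (auto simp: polys_def)
  show ?thesis
  proof (rule additive_subgroupI[OF M.abelian_group_axioms])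
    show "stanley_space M w A \<subseteq> carrier M"
      using assms A smult_closed by (auto simp: stanley_space_def)
    show "stanley_space M w A \<noteq> {}"
      using polys_zero by (auto simp: stanley_space_def)
  next
    fix x y assume "x \<in> stanley_space M w A"
    then obtain p where p: "p \<in> polys A" "x = p \<odot>\<^bsub>M\<^esub> w" by (auto simp: stanley_space_def)
    have "\<ominus>\<^bsub>M\<^esub> x = (- p) \<odot>\<^bsub>M\<^esub> w"
      using smult_l_minus[of p w] assms A p by (simp add: a_inv_poly_ring)
    then show "\<ominus>\<^bsub>M\<^esub> x \<in> stanley_space M w A"
      using p polys_uminus by (auto simp: stanley_space_def)
    assume "y \<in> stanley_space M w A"
    then obtain q where q: "q \<in> polys A" "y = q \<odot>\<^bsub>M\<^esub> w" by (auto simp: stanley_space_def)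
    have "x \<oplus>\<^bsub>M\<^esub> y = (p + q) \<odot>\<^bsub>M\<^esub> w"
      using smult_l_distr[of p q w] assms A p q by simp
    then show "x \<oplus>\<^bsub>M\<^esub> y \<in> stanley_space M w A"
      using p q polys_add by (auto simp: stanley_space_def)
  qed
qed

end

theory Submission
  imports Defs "HOL-Library.Disjoint_Sets"
begin

text \<open>
  Let \<open>k = (n + 2) div 3\<close> be \<open>n / 3\<close> rounded up. The quotient has Stanley depth at most \<open>k\<close> and the
  ideal has Stanley depth at least \<open>k + 1\<close>.

  Upper bound. The middle column contains an independent set \<open>D\<close> of \<open>k\<close> vertices such that every
  vertex outside \<open>D\<close> has a neighbour in \<open>D\<close>: cut the rows into \<open>k\<close> consecutive blocks of three, of
  which the last may be shorter, and take the second row of each block, or its first if there is no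
  second. The product of the variables in \<open>D\<close> is not in the edge ideal, but its product
  with any further variable is. In a Stanley decomposition of the quotient, a space \<open>w K[A]\<close> that
  contributes to this monomial therefore has \<open>A \<subseteq> D\<close>, since it is free
  (\<open>quotient_stanley_space_bound\<close>).

  Lower bound. A monomial lies in an edge ideal iff its support contains an edge, and the monomials
  with support between \<open>C\<close> and \<open>D\<close> are exactly those of the Stanley space \<open>x\<^sub>C K[D]\<close>. So a partition
  into intervals \<open>{C..D}\<close> of the family of vertex sets that contain an edge yields a Stanley
  decomposition of the ideal (\<open>stanley_decomposition_of_intervals\<close>), and its Stanley depth is the
  smallest size of an upper end \<open>D\<close>. Such partitions can be built by deleting vertices. A set that
  contains an edge either avoids a given vertex \<open>v\<close>, or contains \<open>v\<close> and one of its neighbours, or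
  consists of \<open>v\<close> and a set that contains an edge and avoids \<open>v\<close> and all its neighbours. In the last
  case \<open>v\<close> adds one to the upper ends; in the middle case the intervals are large
  (\<open>interval_partition_vertex\<close>). Apply this in turn to the neighbours \<open>y\<close> of a vertex \<open>x\<close> in the first
  row. Each time, the third kind of sets gains one and loses at most the first three rows; after the
  last neighbour \<open>x\<close> is isolated, which gains one too. So three rows are
  traded for an increase of the depth by one, and the last rows give depth two
  (\<open>interval_partition_levels\<close>).
\<close>

section \<open>Interval partitions of families of finite sets\<close>

text \<open>
  The condition \<open>C \<subseteq> D\<close> matters although an empty interval would be harmless in a partition: the
  space \<open>x\<^sub>C K[D]\<close> attached to the pair is never zero, and it is the span of the
  monomials with support in \<open>{C..D}\<close> only if \<open>C \<subseteq> D\<close>.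
\<close>

inductive interval_partition :: "nat \<Rightarrow> 'a set set \<Rightarrow> bool" for d where
  empty: "interval_partition d {}"
| add: "\<lbrakk>interval_partition d F; C \<subseteq> D; finite D; d \<le> card D; {C..D} \<inter> F = {}\<rbrakk>
    \<Longrightarrow> interval_partition d ({C..D} \<union> F)"

lemma interval_partition_mono:
  assumes "interval_partition d F" "d' \<le> d"
  shows "interval_partition d' F"
  using assms(1)
proof induction
  case (add F C D)
  then show ?case using assms(2) by (intro interval_partition.add) auto
qed (rule interval_partition.empty)

lemma interval_partition_Un:
  assumes "interval_partition d F" "interval_partition d G" "F \<inter> G = {}"
  shows "interval_partition d (F \<union> G)"
  using assms(1,3)
proof induction
  case (add F C D)
  then have "interval_partition d ({C..D} \<union> (F \<union> G))"
    by (intro interval_partition.add) auto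
  then show ?case by (simp add: Un_assoc)
qed (simp add: assms(2))

lemma insert_image_interval:
  assumes "C \<subseteq> D" "v \<notin> D"
  shows "insert v ` {C..D} = {insert v C..insert v D}"
proof
  show "{insert v C..insert v D} \<subseteq> insert v ` {C..D}"
  proof
    fix U assume "U \<in> {insert v C..insert v D}"
    then show "U \<in> insert v ` {C..D}"
      using assms by (intro image_eqI[of _ _ "U - {v}"]) auto
  qed
qed auto

text \<open>
  Multiplication by a new variable \<open>v\<close> that may be repeated: in terms of monomials, from a partition for
  \<open>J\<close> this makes one for \<open>v J[v]\<close>, so that each Stanley space gains the variable \<open>v\<close>.
\<close>

lemma interval_partition_insert:
  assumes "interval_partition d F" "\<And>U. U \<in> F \<Longrightarrow> v \<notin> U"
  shows "interval_partition (Suc d) (insert v ` F)"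
  using assms
proof induction
  case (add F C D)
  have v: "v \<notin> D" using add.prems[of D] add.hyps by auto
  have "interval_partition (Suc d) ({insert v C..insert v D} \<union> insert v ` F)"
  proof (rule interval_partition.add)
    show "interval_partition (Suc d) (insert v ` F)" using add.IH add.prems by auto
    show "Suc d \<le> card (insert v D)" using add.hyps v by simp
    have "U \<noteq> U'" if "insert v U = insert v U'" "U \<in> {C..D}" "U' \<in> F" for U U'
      using add.hyps that by blast
    moreover have "U = U'" if "insert v U = insert v U'" "U \<in> {C..D}" "U' \<in> F" for U U'
      using that v add.prems by (metis UnI1 UnI2 insert_ident)
    ultimately show "{insert v C..insert v D} \<inter> insert v ` F = {}"
      unfolding insert_image_interval[OF add.hyps(2) v, symmetric] by blast
  qed (use add.hyps in auto)
  then show ?case by (simp add: image_Un insert_image_interval[OF add.hyps(2) v])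
qed (simp add: interval_partition.empty)

text \<open>
  Adjoining a free variable \<open>v\<close>, which may occur or not: replace \<open>{C..D}\<close> by \<open>{C..insert v D}\<close>.
\<close>

lemma interval_partition_cone:
  assumes "interval_partition d F" "\<And>U. U \<in> F \<Longrightarrow> v \<notin> U"
  shows "interval_partition (Suc d) (F \<union> insert v ` F)"
  using assms
proof induction
  case (add F C D)
  have v: "v \<notin> D" using add.prems[of D] add.hyps by auto
  have eq: "{C..D} \<union> insert v ` {C..D} = {C..insert v D}"
    using v add.hyps(2) by (fastforce simp: insert_image_interval)
  have "interval_partition (Suc d) ({C..insert v D} \<union> (F \<union> insert v ` F))"
  proof (rule interval_partition.add)
    show "interval_partition (Suc d) (F \<union> insert v ` F)" using add.IH add.prems by auto
    show "Suc d \<le> card (insert v D)" using add.hyps v by simp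
    have "U - {v} \<in> {C..D}" if "U \<in> {C..insert v D}" for U
      using that v add.hyps(2) by auto
    moreover have "U - {v} \<in> F" if "U \<in> F \<union> insert v ` F" for U
      using that add.prems by auto
    ultimately show "{C..insert v D} \<inter> (F \<union> insert v ` F) = {}"
      using add.hyps by blast
  qed (use add.hyps in auto)
  also have "{C..insert v D} \<union> (F \<union> insert v ` F) = {C..D} \<union> F \<union> insert v ` ({C..D} \<union> F)"
    unfolding eq[symmetric] by blast
  finally show ?case .
qed (simp add: interval_partition.empty)

text \<open>
  Classify the sets by the first element of \<open>Y\<close> that they contain, for some enumeration of \<open>Y\<close>. Each
  class is an interval whose upper end is \<open>W\<close> without the earlier elements of \<open>Y\<close>; at most
  \<open>card Y - 1\<close> elements are missing, which explains the \<open>Suc\<close>.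
\<close>

lemma interval_partition_meeting:
  assumes "finite Y" "finite W" "Y \<subseteq> W" "C \<subseteq> W" "C \<inter> Y = {}" "d \<le> Suc (card (W - Y))"
  shows "interval_partition d {U. C \<subseteq> U \<and> U \<subseteq> W \<and> U \<inter> Y \<noteq> {}}"
  using assms
proof (induction arbitrary: W)
  case empty
  then show ?case by (simp add: interval_partition.empty)
next
  case (insert y Y)
  have "interval_partition d ({insert y C..W} \<union> {U. C \<subseteq> U \<and> U \<subseteq> W - {y} \<and> U \<inter> Y \<noteq> {}})"
  proof (rule interval_partition.add)
    have "W - {y} - Y = W - insert y Y" by auto
    then show "interval_partition d {U. C \<subseteq> U \<and> U \<subseteq> W - {y} \<and> U \<inter> Y \<noteq> {}}"
      using insert by (intro insert.IH) auto
    have "Suc (card (W - insert y Y)) = card (insert y (W - insert y Y))"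
      using insert.prems by (subst card_insert_disjoint) auto
    also have "\<dots> \<le> card W"
      using insert.prems by (intro card_mono) auto
    finally show "d \<le> card W" using insert.prems by simp
  qed (use insert.prems in auto)
  also have "{insert y C..W} \<union> {U. C \<subseteq> U \<and> U \<subseteq> W - {y} \<and> U \<inter> Y \<noteq> {}}
      = {U. C \<subseteq> U \<and> U \<subseteq> W \<and> U \<inter> insert y Y \<noteq> {}}"
    by auto
  finally show ?case .
qed

text \<open>
  The intervals \<open>{U..U}\<close> give no control of the depth, but they show that a Stanley decomposition exists.
\<close>

lemma interval_partition_singletons:
  assumes "finite V" "F \<subseteq> Pow V"
  shows "interval_partition 0 F"
proof -
  have "finite F" using assms by (meson finite_Pow_iff finite_subset)
  then show ?thesis
    using assms(2)
  proof induction
    case (insert U F)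
    then have "finite U" using assms(1) finite_subset by auto
    then have "interval_partition 0 ({U..U} \<union> F)"
      using insert by (intro interval_partition.add) auto
    then show ?case by simp
  qed (rule interval_partition.empty)
qed

lemma interval_partition_indexed:
  assumes "interval_partition d F"
  obtains r :: nat and C D where "\<And>i. i \<in> {1..r} \<Longrightarrow> C i \<subseteq> D i \<and> d \<le> card (D i)"
    "disjoint_family_on (\<lambda>i. {C i..D i}) {1..r}" "F = (\<Union>i\<in>{1..r}. {C i..D i})"
proof -
  have "\<exists>(r :: nat) C D. (\<forall>i \<in> {1..r}. C i \<subseteq> D i \<and> d \<le> card (D i)) \<and>
    disjoint_family_on (\<lambda>i. {C i..D i}) {1..r} \<and> F = (\<Union>i\<in>{1..r}. {C i..D i})"
    using assms
  proof induction
    case empty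
    show ?case by (rule exI[of _ 0]) (simp add: disjoint_family_on_def)
  next
    case (add F C D)
    from add.IH obtain r :: nat and C' D' where IH:
      "\<forall>i \<in> {1..r}. C' i \<subseteq> D' i \<and> d \<le> card (D' i)"
      "disjoint_family_on (\<lambda>i. {C' i..D' i}) {1..r}" "F = (\<Union>i\<in>{1..r}. {C' i..D' i})"
      by blast
    define C'' where "C'' = C'(Suc r := C)"
    define D'' where "D'' = D'(Suc r := D)"
    have old: "C'' i = C' i" "D'' i = D' i" if "i \<in> {1..r}" for i
      using that by (auto simp: C''_def D''_def)
    have new: "C'' (Suc r) = C" "D'' (Suc r) = D" by (simp_all add: C''_def D''_def)
    have ix: "{1..Suc r} = insert (Suc r) {1..r}" by auto
    have un: "(\<Union>i\<in>{1..r}. {C'' i..D'' i}) = F"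
      unfolding IH(3) by (intro SUP_cong refl) (simp add: old)
    have "disjoint_family_on (\<lambda>i. {C'' i..D'' i}) {1..r}"
      using IH(2) old by (simp add: disjoint_family_on_def)
    then have "disjoint_family_on (\<lambda>i. {C'' i..D'' i}) {1..Suc r}"
      unfolding ix using add.hyps(5) un new
      by (subst disjoint_family_on_insert) auto
    moreover have "{C..D} \<union> F = (\<Union>i\<in>{1..Suc r}. {C'' i..D'' i})"
      unfolding ix using un new by simp
    moreover have "\<forall>i \<in> {1..Suc r}. C'' i \<subseteq> D'' i \<and> d \<le> card (D'' i)"
      unfolding ix using IH(1) old new add.hyps by simp
    ultimately show ?case by blast
  qed
  then show ?thesis using that by blast
qed

section \<open>Vertex sets that contain an edge\<close>

definition dependent_sets :: "'v set set \<Rightarrow> 'v set \<Rightarrow> 'v set set" where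
  "dependent_sets E W = {U. U \<subseteq> W \<and> (\<exists>e\<in>E. e \<subseteq> U)}"

definition neighbours :: "'v set set \<Rightarrow> 'v \<Rightarrow> 'v set" where
  "neighbours E v = {y. {v, y} \<in> E}"

lemma edge_cases:
  assumes "e \<in> E" "v \<in> e" "card e = 2"
  obtains y where "e = {v, y}" "y \<in> neighbours E v" "y \<noteq> v"
proof -
  from assms(3) obtain p q where "e = {p, q}" "p \<noteq> q" by (auto simp: card_2_iff)
  with assms that show thesis unfolding neighbours_def by (metis (mono_tags, lifting) insertE insert_commute mem_Collect_eq singletonD)
qed

lemma dependent_sets_vertex:
  assumes "\<forall>e\<in>E. card e = 2" "v \<in> W"
  shows "dependent_sets E W = dependent_sets E (W - {v})
    \<union> insert v ` dependent_sets E (W - {v} - neighbours E v)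
    \<union> {U. {v} \<subseteq> U \<and> U \<subseteq> W \<and> U \<inter> (neighbours E v \<inter> W) \<noteq> {}}" (is "_ = ?A \<union> ?B \<union> ?C")
proof
  show "dependent_sets E W \<subseteq> ?A \<union> ?B \<union> ?C"
  proof
    fix U assume "U \<in> dependent_sets E W"
    then obtain e where U: "U \<subseteq> W" "e \<in> E" "e \<subseteq> U" by (auto simp: dependent_sets_def)
    consider "v \<notin> U" | "v \<in> U" "U \<inter> neighbours E v = {}" | "v \<in> U" "U \<inter> neighbours E v \<noteq> {}"
      by blast
    then show "U \<in> ?A \<union> ?B \<union> ?C"
    proof cases
      case 2
      have "v \<notin> e"
      proof
        assume "v \<in> e"
        then obtain y where "e = {v, y}" "y \<in> neighbours E v"
          using edge_cases[OF U(2)] bspec[OF assms(1) U(2)] by blast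
        then show False using U(3) 2(2) by blast
      qed
      with U 2 have "U - {v} \<in> dependent_sets E (W - {v} - neighbours E v)"
        by (auto simp: dependent_sets_def)
      moreover have "U = insert v (U - {v})" using 2 by auto
      ultimately show ?thesis by blast
    qed (use U in \<open>auto simp: dependent_sets_def\<close>)
  qed
  show "?A \<union> ?B \<union> ?C \<subseteq> dependent_sets E W"
  proof (intro Un_least subsetI)
    fix U assume "U \<in> ?B"
    then obtain U' e where "U = insert v U'" "U' \<subseteq> W" "e \<in> E" "e \<subseteq> U'"
      by (auto simp: dependent_sets_def)
    then show "U \<in> dependent_sets E W"
      using assms(2) by (auto simp: dependent_sets_def)
  next
    fix U assume "U \<in> ?C"
    then obtain y where "{v, y} \<in> E" "{v, y} \<subseteq> U" "U \<subseteq> W"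
      by (auto simp: neighbours_def)
    then show "U \<in> dependent_sets E W"
      unfolding dependent_sets_def by blast
  qed (auto simp: dependent_sets_def)
qed

text \<open>
  The three kinds of sets of the previous lemma are partitioned separately. Deleting \<open>v\<close> has to preserve
  the depth, whereas deleting \<open>v\<close> together with its neighbours may lower it by one. In terms of ideals,
  these are the edge ideal of the graph without \<open>v\<close> and the edge part of the colon ideal by \<open>v\<close>.
\<close>

lemma interval_partition_vertex:
  assumes E: "\<forall>e\<in>E. card e = 2" and W: "finite W" "v \<in> W"
    and del: "interval_partition (Suc d) (dependent_sets E (W - {v}))"
    and link: "interval_partition d (dependent_sets E (W - {v} - neighbours E v))"
    and card: "d \<le> card (W - neighbours E v)"
  shows "interval_partition (Suc d) (dependent_sets E W)"
proof -
  have v: "v \<notin> neighbours E v"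
    using bspec[OF E, of "{v}"] by (auto simp: neighbours_def)
  have "W - neighbours E v \<inter> W = W - neighbours E v" by auto
  then have "interval_partition (Suc d)
      {U. {v} \<subseteq> U \<and> U \<subseteq> W \<and> U \<inter> (neighbours E v \<inter> W) \<noteq> {}}"
    using W v card by (intro interval_partition_meeting) auto
  moreover have "interval_partition (Suc d) (insert v ` dependent_sets E (W - {v} - neighbours E v))"
    using link by (rule interval_partition_insert) (auto simp: dependent_sets_def)
  ultimately show ?thesis
    unfolding dependent_sets_vertex[OF E W(2)]
    by (intro interval_partition_Un del) (use v in \<open>auto simp: dependent_sets_def\<close>)
qed

lemma interval_partition_isolated:
  assumes E: "\<forall>e\<in>E. card e = 2" and v: "v \<in> W" "neighbours E v \<inter> W = {}"
    and del: "interval_partition d (dependent_sets E (W - {v}))"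
  shows "interval_partition (Suc d) (dependent_sets E W)"
proof -
  have "W - {v} - neighbours E v = W - {v}" using v by auto
  then have "dependent_sets E W
      = dependent_sets E (W - {v}) \<union> insert v ` dependent_sets E (W - {v})"
    using dependent_sets_vertex[OF E v(1)] v(2) by simp
  moreover have "v \<notin> U" if "U \<in> dependent_sets E (W - {v})" for U
    using that by (auto simp: dependent_sets_def)
  ultimately show ?thesis
    using interval_partition_cone[OF del] by simp
qed

text \<open>
  Both deletions in the vertex step keep depth two by induction, which is more than the step asks of the
  second one, and the condition on the size holds because \<open>v\<close> is not its own neighbour.
\<close>

lemma interval_partition_two:
  assumes E: "\<forall>e\<in>E. card e = 2" and "finite W"
  shows "interval_partition 2 (dependent_sets E W)"
  using assms(2)
proof (induction W rule: finite_psubset_induct)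
  case (psubset W)
  show ?case
  proof (cases "W = {}")
    case True
    have "{} \<notin> E" using bspec[OF E, of "{}"] by auto
    then have "dependent_sets E W = {}"
      using True by (auto simp: dependent_sets_def)
    then show ?thesis by (simp add: interval_partition.empty)
  next
    case False
    then obtain v where v: "v \<in> W" by blast
    have IH: "interval_partition 2 (dependent_sets E (W - {v} - X))" for X
      using v by (intro psubset.IH) blast
    have "v \<notin> neighbours E v"
      using bspec[OF E, of "{v}"] by (auto simp: neighbours_def)
    then have "card {v} \<le> card (W - neighbours E v)"
      using v psubset.hyps by (intro card_mono) simp_all
    then have card: "1 \<le> card (W - neighbours E v)" by simp
    have "interval_partition (Suc 1) (dependent_sets E W)"
    proof (rule interval_partition_vertex[OF E psubset.hyps v _ _ card])
      show "interval_partition (Suc 1) (dependent_sets E (W - {v}))"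
        using IH[of "{}"] by (simp add: numeral_2_eq_2)
      show "interval_partition 1 (dependent_sets E (W - {v} - neighbours E v))"
        by (rule interval_partition_mono[OF IH]) simp
    qed
    then show ?thesis by (simp add: numeral_2_eq_2)
  qed
qed

text \<open>
  The vertex step is applied to the elements of \<open>Y\<close>, a set that contains all neighbours of \<open>x\<close> in \<open>W\<close>,
  until \<open>x\<close> is isolated. Deleting one of them alone costs nothing, because it only leads to the next step: the gain of one comes from
  the element \<open>y\<close> that is kept, or at the end from \<open>x\<close>. The set \<open>Z\<close> stands for the vertices left when
  \<open>y\<close> is processed.
\<close>

lemma interval_partition_neighbours:
  assumes E: "\<forall>e\<in>E. card e = 2" and "finite Y"
    and "finite W" "x \<in> W" "neighbours E x \<inter> W \<subseteq> Y" "Y \<subseteq> W - {x}"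
    and "\<And>y Z. \<lbrakk>y \<in> Y; W - Y \<subseteq> Z; y \<in> Z; Z \<subseteq> W\<rbrakk> \<Longrightarrow>
      interval_partition d (dependent_sets E (Z - {y} - neighbours E y)) \<and> d \<le> card (Z - neighbours E y)"
    and "interval_partition d (dependent_sets E (W - Y - {x}))"
  shows "interval_partition (Suc d) (dependent_sets E W)"
  using assms(2-)
proof (induction arbitrary: W)
  case empty
  then show ?case by (intro interval_partition_isolated[OF E, of x]) auto
next
  case (insert y Y)
  have eq: "W - {y} - Y = W - insert y Y" by auto
  have del: "interval_partition (Suc d) (dependent_sets E (W - {y}))"
  proof (rule insert.IH; (unfold eq)?)
    fix z Z assume "z \<in> Y" "W - insert y Y \<subseteq> Z" "z \<in> Z" "Z \<subseteq> W - {y}"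
    then show "interval_partition d (dependent_sets E (Z - {z} - neighbours E z)) \<and>
        d \<le> card (Z - neighbours E z)"
      by (intro insert.prems(5)) auto
  qed (use insert.prems insert.hyps in auto)
  have "interval_partition d (dependent_sets E (W - {y} - neighbours E y)) \<and> d \<le> card (W - neighbours E y)"
    using insert.prems by (intro insert.prems(5)) auto
  then show ?case
    using insert.prems del by (intro interval_partition_vertex[OF E, of W y]) auto
qed

text \<open>
  The function \<open>level\<close> changes by at most one along an edge, and all levels between \<open>a\<close> and \<open>b\<close> are
  occupied. Around a vertex \<open>x\<close> of level \<open>a\<close>, a neighbour of \<open>x\<close> has level at most \<open>a + 1\<close> and
  its neighbours have level at most \<open>a + 2\<close>, so the vertices of level at least \<open>a + 3\<close>
  survive in every branch and the induction applies to them. Vertices of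
  level below \<open>a\<close> are admitted because the branches leave an uncontrolled part of the lower levels.
  When at most three levels remain, depth two suffices: the bound is the number \<open>b - a + 1\<close> of levels
  divided by three, rounded up, plus one.
\<close>

lemma interval_partition_levels:
  fixes level :: "'v \<Rightarrow> nat"
  assumes E: "\<forall>e\<in>E. card e = 2"
    and step: "\<And>u v. {u, v} \<in> E \<Longrightarrow> level v \<le> Suc (level u)"
    and "finite W" "\<And>i. a \<le> i \<Longrightarrow> i \<le> b \<Longrightarrow> \<exists>v\<in>W. level v = i"
  shows "interval_partition (Suc ((b - a + 3) div 3)) (dependent_sets E W)"
  using assms(3-)
proof (induction "b - a" arbitrary: a W rule: less_induct)
  case less
  show ?case
  proof (cases "b - a < 3")
    case True
    then have "Suc ((b - a + 3) div 3) = 2" by simp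
    then show ?thesis using interval_partition_two[OF E less.prems(1)] by (simp add: numeral_2_eq_2)
  next
    case False
    define d where "d = (b - a + 3) div 3"
    have d: "d = Suc ((b - (a + 3) + 3) div 3)" using False by (simp add: d_def)
    have far: "interval_partition d (dependent_sets E Z)"
      if "Z \<subseteq> W" "\<And>v. v \<in> W \<Longrightarrow> a + 3 \<le> level v \<Longrightarrow> v \<in> Z" for Z
      unfolding d
    proof (rule less.hyps)
      show "finite Z" using that less.prems finite_subset by blast
      show "\<exists>v\<in>Z. level v = i" if "a + 3 \<le> i" "i \<le> b" for i
        using less.prems(2)[of i] \<open>\<And>v. v \<in> W \<Longrightarrow> a + 3 \<le> level v \<Longrightarrow> v \<in> Z\<close> that by auto
    qed (use False in auto)
    have "a \<le> b" using False by simp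
    then obtain x where x: "x \<in> W" "level x = a" using less.prems(2)[of a] by blast
    define Y where "Y = neighbours E x \<inter> W"
    have lev_Y: "level y \<le> a + 1" if "y \<in> Y" for y
      using step[of x y] that x by (simp add: Y_def neighbours_def)
    have lev_N: "level z \<le> a + 2" if "y \<in> Y" "z \<in> neighbours E y" for y z
      using step[of y z] lev_Y[OF that(1)] that(2) by (simp add: neighbours_def)
    have irrefl: "y \<notin> neighbours E y" for y
      using bspec[OF E, of "{y}"] by (auto simp: neighbours_def)
    have "interval_partition (Suc d) (dependent_sets E W)"
    proof (rule interval_partition_neighbours[OF E _ less.prems(1) x(1)])
      show "finite Y" "neighbours E x \<inter> W \<subseteq> Y" "Y \<subseteq> W - {x}"
        using less.prems(1) irrefl[of x] by (auto simp: Y_def)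
      show "interval_partition d (dependent_sets E (W - Y - {x}))"
        using lev_Y x by (intro far) fastforce+
      fix y Z assume y: "y \<in> Y" "W - Y \<subseteq> Z" "y \<in> Z" "Z \<subseteq> W"
      have keep: "v \<in> Z - {y} - neighbours E y" if "v \<in> W" "a + 3 \<le> level v" for v
        using that y lev_Y[of v] lev_Y[of y] lev_N[of y v] by fastforce
      \<comment> \<open>The levels from \<open>a + 3\<close> on and the vertex \<open>y\<close> itself leave enough vertices for the
        sets that contain \<open>y\<close> and a neighbour of \<open>y\<close>.\<close>
      have "insert (level y) {a + 3..b} \<subseteq> level ` (Z - neighbours E y)"
      proof -
        have "i \<in> level ` (Z - neighbours E y)" if "i \<in> {a + 3..b}" for i
        proof -
          from that less.prems(2)[of i] obtain v where "v \<in> W" "level v = i" by auto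
          then show ?thesis using keep[of v] \<open>i \<in> {a + 3..b}\<close> by auto
        qed
        then show ?thesis using y irrefl[of y] by auto
      qed
      moreover have finZ: "finite (Z - neighbours E y)"
        using y(4) less.prems(1) by (meson finite_Diff finite_subset)
      ultimately have "card (insert (level y) {a + 3..b}) \<le> card (level ` (Z - neighbours E y))"
        by (intro card_mono) simp_all
      also have "\<dots> \<le> card (Z - neighbours E y)"
        by (rule card_image_le[OF finZ])
      also have "card (insert (level y) {a + 3..b}) = b - a - 1"
        using lev_Y[OF y(1)] False by (subst card_insert_disjoint) auto
      finally have "d \<le> card (Z - neighbours E y)"
        using False unfolding d_def by linarith
      moreover have "interval_partition d (dependent_sets E (Z - {y} - neighbours E y))"
        using y keep by (intro far) auto
      ultimately show "interval_partition d (dependent_sets E (Z - {y} - neighbours E y)) \<and>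
          d \<le> card (Z - neighbours E y)" by simp
    qed
    then show ?thesis by (simp add: d_def)
  qed
qed

section \<open>Monomials and their supports\<close>

definition squarefree_monomial :: "'v set \<Rightarrow> 'v \<Rightarrow>\<^sub>0 nat" where
  "squarefree_monomial C = (\<Sum>v\<in>C. Poly_Mapping.single v 1)"

lemma lookup_squarefree_monomial:
  "finite C \<Longrightarrow> Poly_Mapping.lookup (squarefree_monomial C) v = (if v \<in> C then 1 else 0)"
  by (simp add: squarefree_monomial_def lookup_sum lookup_single when_def)

lemma keys_squarefree_monomial: "finite C \<Longrightarrow> Poly_Mapping.keys (squarefree_monomial C) = C"
  by (auto simp: in_keys_iff lookup_squarefree_monomial split: if_splits)

lemma monomial_dividesE:
  fixes u w :: "'v \<Rightarrow>\<^sub>0 nat"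
  assumes "\<And>v. Poly_Mapping.lookup w v \<le> Poly_Mapping.lookup u v"
  obtains t where "u = t + w" "Poly_Mapping.keys t \<subseteq> Poly_Mapping.keys u"
proof
  show "u = (u - w) + w"
    using assms by (intro poly_mapping_eqI) (simp add: lookup_add lookup_minus)
  show "Poly_Mapping.keys (u - w) \<subseteq> Poly_Mapping.keys u"
    by (auto simp: in_keys_iff lookup_minus)
qed

lemma keys_add_nat:
  fixes s t :: "'v \<Rightarrow>\<^sub>0 nat"
  shows "Poly_Mapping.keys (s + t) = Poly_Mapping.keys s \<union> Poly_Mapping.keys t"
  by (auto simp: in_keys_iff lookup_add)

lemma poly_eq_sum_monomials:
  "p = (\<Sum>u\<in>Poly_Mapping.keys p. Poly_Mapping.single u (Poly_Mapping.lookup p u))"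
  by (rule poly_mapping_eqI) (auto simp: lookup_sum lookup_single when_def in_keys_iff)

lemma times_monomial:
  fixes p :: "('v, 'k::field) mpoly"
  shows "p * Poly_Mapping.single w 1
    = (\<Sum>t\<in>Poly_Mapping.keys p. Poly_Mapping.single (t + w) (Poly_Mapping.lookup p t))"
  by (subst poly_eq_sum_monomials[of p]) (simp add: sum_distrib_right mult_single)

text \<open>
  Multiplication by a monomial translates the exponents, hence it can be cancelled.
\<close>

lemma lookup_times_monomial:
  fixes p :: "('v, 'k::field) mpoly"
  shows "Poly_Mapping.lookup (p * Poly_Mapping.single w 1) (t + w) = Poly_Mapping.lookup p t"
  by (auto simp: times_monomial lookup_sum lookup_single when_def in_keys_iff)

lemma keys_times_monomial:
  fixes p :: "('v, 'k::field) mpoly"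
  shows "Poly_Mapping.keys (p * Poly_Mapping.single w 1) = (\<lambda>t. t + w) ` Poly_Mapping.keys p"
proof -
  have "Poly_Mapping.keys (p * Poly_Mapping.single w 1) \<subseteq> (\<lambda>t. t + w) ` Poly_Mapping.keys p"
    using keys_mult[of p "Poly_Mapping.single w 1"] by auto
  then show ?thesis
    by (auto simp: in_keys_iff lookup_times_monomial)
qed

definition poly_restrict :: "('v \<Rightarrow>\<^sub>0 nat) set \<Rightarrow> ('v, 'k::field) mpoly \<Rightarrow> ('v, 'k) mpoly" where
  "poly_restrict S p = (\<Sum>u\<in>Poly_Mapping.keys p \<inter> S. Poly_Mapping.single u (Poly_Mapping.lookup p u))"

lemma lookup_poly_restrict:
  "Poly_Mapping.lookup (poly_restrict S p) u = (if u \<in> S then Poly_Mapping.lookup p u else 0)"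
  by (auto simp: poly_restrict_def lookup_sum lookup_single when_def in_keys_iff)

lemma keys_poly_restrict: "Poly_Mapping.keys (poly_restrict S p) = Poly_Mapping.keys p \<inter> S"
  by (auto simp: in_keys_iff lookup_poly_restrict split: if_splits)

text \<open>
  The Stanley space \<open>x\<^sub>C K[D]\<close> consists of the polynomials whose monomials have support between \<open>C\<close>
  and \<open>D\<close>: a monomial is divisible by \<open>x\<^sub>C\<close> iff its support contains \<open>C\<close>, and because \<open>C \<subseteq> D\<close> the
  cofactor lies in \<open>K[D]\<close> iff the support is contained in \<open>D\<close>.
\<close>

lemma cone_eq_interval:
  assumes "C \<subseteq> D" "finite D"
  shows "(\<lambda>p. p * Poly_Mapping.single (squarefree_monomial C) 1) ` polys D
    = {q :: ('v, 'k::field) mpoly. \<forall>u\<in>Poly_Mapping.keys q. Poly_Mapping.keys u \<in> {C..D}}"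
    (is "?f ` _ = ?R")
proof
  have C: "finite C" using assms finite_subset by blast
  show "?f ` polys D \<subseteq> ?R"
    using assms(1) by (fastforce simp: keys_times_monomial keys_add_nat keys_squarefree_monomial[OF C] polys_def)
  show "?R \<subseteq> ?f ` polys D"
  proof
    fix q assume q: "q \<in> ?R"
    let ?w = "squarefree_monomial C"
    define p where "p = (\<Sum>u\<in>Poly_Mapping.keys q.
      Poly_Mapping.single (u - ?w) (Poly_Mapping.lookup q u))"
    have div: "u - ?w + ?w = u \<and> Poly_Mapping.keys (u - ?w) \<subseteq> D"
      if u: "u \<in> Poly_Mapping.keys q" for u
    proof -
      have sub: "C \<subseteq> Poly_Mapping.keys u" "Poly_Mapping.keys u \<subseteq> D" using q u by auto
      then have "Poly_Mapping.lookup ?w v \<le> Poly_Mapping.lookup u v" for v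
        by (auto simp: lookup_squarefree_monomial[OF C] in_keys_iff Suc_le_eq)
      then obtain t where "u = t + ?w" "Poly_Mapping.keys t \<subseteq> Poly_Mapping.keys u"
        using monomial_dividesE by blast
      with sub show ?thesis by simp
    qed
    have "p \<in> polys D"
      unfolding p_def using div by (intro polys_sum polys_single) auto
    moreover have "?f p = (\<Sum>u\<in>Poly_Mapping.keys q. Poly_Mapping.single u (Poly_Mapping.lookup q u))"
      unfolding p_def sum_distrib_right mult_single using div by (intro sum.cong) auto
    then have "?f p = q"
      using poly_eq_sum_monomials[of q] by simp
    ultimately show "q \<in> ?f ` polys D" by blast
  qed
qed

section \<open>Stanley decompositions from interval partitions\<close>

text \<open>
  A common frame for a monomial ideal and for the quotient by one. Both have a vector space basis
  indexed by a set \<open>B\<close> of monomials, namely those inside and those outside the ideal, and \<open>c\<close> sends a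
  linear combination of monomials in \<open>B\<close> to the element of the module that it represents. The module
  action is recorded only where the product stays in the span of \<open>B\<close>, as it does throughout a Stanley
  space.
\<close>

locale monomial_basis = multigraded_module V M gr
  for V :: "'v set" and M :: "(('v, 'k::field) mpoly, 'm) module" and gr +
  fixes c :: "('v, 'k) mpoly \<Rightarrow> 'm" and B :: "('v \<Rightarrow>\<^sub>0 nat) set"
  assumes basis_vars: "u \<in> B \<Longrightarrow> Poly_Mapping.keys u \<subseteq> V"
    and bij: "bij_betw c {p. Poly_Mapping.keys p \<subseteq> B} (carrier M)"
    and add: "\<lbrakk>Poly_Mapping.keys p \<subseteq> B; Poly_Mapping.keys q \<subseteq> B\<rbrakk> \<Longrightarrow> c (p + q) = c p \<oplus>\<^bsub>M\<^esub> c q"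
    and smult: "\<lbrakk>p \<in> polys V; Poly_Mapping.keys q \<subseteq> B; Poly_Mapping.keys (p * q) \<subseteq> B\<rbrakk>
      \<Longrightarrow> p \<odot>\<^bsub>M\<^esub> c q = c (p * q)"
    and homogeneous: "u \<in> B \<Longrightarrow> c (Poly_Mapping.single u 1) \<in> gr (mdeg u)"
begin

sublocale module "poly_ring V" M by (rule is_module)

lemma c_closed: "Poly_Mapping.keys p \<subseteq> B \<Longrightarrow> c p \<in> carrier M"
  using bij by (auto simp: bij_betw_def)

lemma c_eq_iff: "\<lbrakk>Poly_Mapping.keys p \<subseteq> B; Poly_Mapping.keys q \<subseteq> B\<rbrakk> \<Longrightarrow> c p = c q \<longleftrightarrow> p = q"
  using bij by (auto simp: bij_betw_def inj_on_def)

lemma c_zero: "c 0 = \<zero>\<^bsub>M\<^esub>"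
  using add[of 0 0] c_closed[of 0] M.add.r_cancel_one' by simp

lemma c_sum:
  assumes "finite I" "\<And>i. i \<in> I \<Longrightarrow> Poly_Mapping.keys (f i) \<subseteq> B"
  shows "Poly_Mapping.keys (sum f I) \<subseteq> B \<and> c (sum f I) = (\<Oplus>\<^bsub>M\<^esub>i\<in>I. c (f i))"
  using assms
proof induction
  case (insert i I)
  then have "Poly_Mapping.keys (f i + sum f I) \<subseteq> B"
    using Poly_Mapping.keys_add[of "f i" "sum f I"] by auto
  with insert show ?case
    by (subst M.finsum_insert) (auto simp: add c_closed)
qed (simp add: c_zero)

text \<open>
  Since the interval of the support is unique, each monomial of \<open>B\<close> lies in exactly one of the spaces
  \<open>x\<^sub>C K[D]\<close>. Splitting an element according to the spaces of its monomials gives its components, and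
  comparing coefficients shows that there is no other choice.
\<close>

lemma stanley_decomposition_of_intervals:
  assumes CD: "\<And>i. i \<in> {1..r} \<Longrightarrow> C i \<subseteq> D i"
    and disj: "disjoint_family_on (\<lambda>i. {C i..D i}) {1..r}"
    and un: "B = {u. Poly_Mapping.keys u \<in> (\<Union>i\<in>{1..r}. {C i..D i})}"
    and D: "\<And>i. i \<in> {1..r} \<Longrightarrow> D i \<subseteq> V"
  shows "stanley_decomposition V M gr r
    (\<lambda>i. c (Poly_Mapping.single (squarefree_monomial (C i)) 1)) D"
proof -
  let ?m = "\<lambda>i. Poly_Mapping.single (squarefree_monomial (C i)) 1 :: ('v, 'k) mpoly"
  let ?S = "\<lambda>i. {u. Poly_Mapping.keys u \<in> {C i..D i}}"
  have fin: "finite (D i)" "finite (C i)" if "i \<in> {1..r}" for i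
    using that CD D finite_vars by (meson finite_subset)+
  have S: "?S i \<subseteq> B" if "i \<in> {1..r}" for i
    using that un by blast
  have polys: "p \<in> polys V" if "p \<in> polys (D i)" "i \<in> {1..r}" for p :: "('v, 'k) mpoly" and i
    using that D by (auto simp: polys_def)
  have mono: "squarefree_monomial (C i) \<in> B" if "i \<in> {1..r}" for i
    using CD[OF that] fin[OF that] by (intro subsetD[OF S[OF that]]) (simp add: keys_squarefree_monomial)
  then have m_keys: "Poly_Mapping.keys (?m i) \<subseteq> B" if "i \<in> {1..r}" for i
    using that by simp
  have keys_cone: "Poly_Mapping.keys (p * ?m i) \<subseteq> ?S i" if "p \<in> polys (D i)" "i \<in> {1..r}" for p i
    using cone_eq_interval[OF CD[OF that(2)] fin(1)[OF that(2)], where 'k = 'k] that(1) by blast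
  have sm: "p \<odot>\<^bsub>M\<^esub> c (?m i) = c (p * ?m i)" if "p \<in> polys (D i)" "i \<in> {1..r}" for p i
    using keys_cone[OF that] S[OF that(2)] m_keys[OF that(2)] polys[OF that] by (intro smult) auto
  have space: "stanley_space M (c (?m i)) (D i) = c ` {q. Poly_Mapping.keys q \<subseteq> ?S i}"
    if i: "i \<in> {1..r}" for i
  proof -
    have "stanley_space M (c (?m i)) (D i) = c ` ((\<lambda>p. p * ?m i) ` polys (D i))"
      unfolding stanley_space_def image_image by (intro image_cong refl sm i)
    also have "\<dots> = c ` {q. Poly_Mapping.keys q \<subseteq> ?S i}"
      unfolding cone_eq_interval[OF CD[OF i] fin(1)[OF i]] by (intro arg_cong[of _ _ "image c"]) auto
    finally show ?thesis .
  qed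
  have "\<exists>a \<in> multidegrees V. c (?m i) \<in> gr a" if "i \<in> {1..r}" for i
  proof
    show "c (?m i) \<in> gr (mdeg (squarefree_monomial (C i)))"
      by (rule homogeneous[OF mono[OF that]])
    show "mdeg (squarefree_monomial (C i)) \<in> multidegrees V"
      using basis_vars[OF mono[OF that]] by (auto simp: multidegrees_def mdeg_def in_keys_iff)
  qed
  moreover have "inj_on (\<lambda>p. p \<odot>\<^bsub>M\<^esub> c (?m i)) (polys (D i))" if "i \<in> {1..r}" for i
  proof (rule inj_onI)
    fix p q assume "p \<in> polys (D i)" "q \<in> polys (D i)" "p \<odot>\<^bsub>M\<^esub> c (?m i) = q \<odot>\<^bsub>M\<^esub> c (?m i)"
    then have "p * ?m i = q * ?m i"
      using that sm keys_cone S by (subst c_eq_iff[symmetric]) (force, force, simp)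
    then show "p = q"
      by (metis lookup_times_monomial poly_mapping_eqI)
  qed
  moreover have "direct_sum M {1..r} (\<lambda>i. stanley_space M (c (?m i)) (D i))"
    unfolding direct_sum_def
  proof (intro conjI ballI)
    fix i assume "i \<in> {1..r}"
    then show "additive_subgroup (stanley_space M (c (?m i)) (D i)) M"
      using m_keys by (intro additive_subgroup_stanley_space D c_closed)
  next
    fix x assume "x \<in> carrier M"
    then obtain q where q: "Poly_Mapping.keys q \<subseteq> B" "x = c q"
      using bij by (auto simp: bij_betw_def)
    define h where "h = (\<lambda>i\<in>{1..r}. c (poly_restrict (?S i) q))"
    have supp: "finsum M f {i \<in> {1..r}. f i \<noteq> \<zero>\<^bsub>M\<^esub>} = finsum M f {1..r}"
      if "f \<in> {1..r} \<rightarrow> carrier M" for f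
      using that by (intro M.add.finprod_mono_neutral_cong_left) auto
    \<comment> \<open>Comparing coefficients: only the component whose interval contains the support of \<open>u\<close>
      contributes to the coefficient of \<open>u\<close>.\<close>
    have lookup_decomp: "Poly_Mapping.lookup (\<Sum>i\<in>{1..r}. f i) u = Poly_Mapping.lookup (f i) u"
      if "\<And>i. i \<in> {1..r} \<Longrightarrow> Poly_Mapping.keys (f i) \<subseteq> ?S i" "i \<in> {1..r}" "u \<in> ?S i"
      for f :: "nat \<Rightarrow> ('v, 'k) mpoly" and i u
    proof -
      have "Poly_Mapping.lookup (f j) u = 0" if "j \<in> {1..r}" "j \<noteq> i" for j
      proof -
        have "{C j..D j} \<inter> {C i..D i} = {}"
          using disj that \<open>i \<in> {1..r}\<close> unfolding disjoint_family_on_def by blast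
        then have "u \<notin> Poly_Mapping.keys (f j)"
          using \<open>u \<in> ?S i\<close> \<open>\<And>i. i \<in> {1..r} \<Longrightarrow> Poly_Mapping.keys (f i) \<subseteq> ?S i\<close>[OF that(1)] by blast
        then show ?thesis by (simp add: in_keys_iff)
      qed
      then show ?thesis
        unfolding lookup_sum using that(2) by (subst sum.remove[of _ i]) auto
    qed
    show "\<exists>!f. f \<in> Pi\<^sub>E {1..r} (\<lambda>i. stanley_space M (c (?m i)) (D i)) \<and>
        finite {i \<in> {1..r}. f i \<noteq> \<zero>\<^bsub>M\<^esub>} \<and>
        x = (\<Oplus>\<^bsub>M\<^esub>i \<in> {i \<in> {1..r}. f i \<noteq> \<zero>\<^bsub>M\<^esub>}. f i)"
    proof (rule ex1I[of _ h], intro conjI)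
      show "h \<in> Pi\<^sub>E {1..r} (\<lambda>i. stanley_space M (c (?m i)) (D i))"
        unfolding h_def by (auto simp: space keys_poly_restrict)
      show "finite {i \<in> {1..r}. h i \<noteq> \<zero>\<^bsub>M\<^esub>}" by simp
      have "(\<Sum>i\<in>{1..r}. poly_restrict (?S i) q) = q"
      proof (rule poly_mapping_eqI)
        fix u
        show "Poly_Mapping.lookup (\<Sum>i\<in>{1..r}. poly_restrict (?S i) q) u = Poly_Mapping.lookup q u"
        proof (cases "u \<in> B")
          case True
          then obtain i where "i \<in> {1..r}" "u \<in> ?S i" unfolding un by auto
          then show ?thesis
            by (subst lookup_decomp[of _ i]) (auto simp: keys_poly_restrict lookup_poly_restrict)
        next
          case False
          then have "Poly_Mapping.lookup q u = 0" using q(1) by (auto simp: in_keys_iff)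
          then show ?thesis by (auto simp: lookup_sum lookup_poly_restrict intro!: sum.neutral)
        qed
      qed
      then have "x = c (\<Sum>i\<in>{1..r}. poly_restrict (?S i) q)" using q(2) by simp
      also have "\<dots> = (\<Oplus>\<^bsub>M\<^esub>i\<in>{1..r}. c (poly_restrict (?S i) q))"
        using q(1) by (intro conjunct2[OF c_sum]) (auto simp: keys_poly_restrict)
      also have "\<dots> = finsum M h {1..r}"
        using q(1) by (intro M.finsum_cong') (auto simp: h_def keys_poly_restrict intro!: c_closed)
      also have "\<dots> = finsum M h {i \<in> {1..r}. h i \<noteq> \<zero>\<^bsub>M\<^esub>}"
        using q(1) by (intro supp[symmetric]) (auto simp: h_def keys_poly_restrict intro!: c_closed)
      finally show "x = finsum M h {i \<in> {1..r}. h i \<noteq> \<zero>\<^bsub>M\<^esub>}" .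
    next
      fix f assume f: "f \<in> Pi\<^sub>E {1..r} (\<lambda>i. stanley_space M (c (?m i)) (D i)) \<and>
        finite {i \<in> {1..r}. f i \<noteq> \<zero>\<^bsub>M\<^esub>} \<and> x = finsum M f {i \<in> {1..r}. f i \<noteq> \<zero>\<^bsub>M\<^esub>}"
      then have "\<forall>i\<in>{1..r}. \<exists>g. Poly_Mapping.keys g \<subseteq> ?S i \<and> f i = c g"
        using space by (fastforce simp: PiE_iff)
      then obtain g where g: "\<And>i. i \<in> {1..r} \<Longrightarrow> Poly_Mapping.keys (g i) \<subseteq> ?S i"
          "\<And>i. i \<in> {1..r} \<Longrightarrow> f i = c (g i)"
        by metis
      have gB: "Poly_Mapping.keys (g i) \<subseteq> B" if "i \<in> {1..r}" for i
        using g(1)[OF that] S[OF that] by blast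
      have "x = finsum M f {1..r}"
        using f supp[of f] g(2) gB c_closed by (auto simp: Pi_iff)
      also have "\<dots> = (\<Oplus>\<^bsub>M\<^esub>i\<in>{1..r}. c (g i))"
        using g(2) gB c_closed by (intro M.finsum_cong') auto
      also have "\<dots> = c (sum g {1..r})"
        using gB by (intro conjunct2[OF c_sum, symmetric]) auto
      finally have "q = sum g {1..r}"
        using q gB c_sum[of "{1..r}" g] by (subst c_eq_iff[symmetric]) auto
      then have "g i = poly_restrict (?S i) q" if "i \<in> {1..r}" for i
        using g(1)[OF that] lookup_decomp[OF g(1) that]
        by (intro poly_mapping_eqI) (auto simp: lookup_poly_restrict in_keys_iff)
      then show "f = h"
        using f g(2) by (intro ext) (auto simp: h_def PiE_iff extensional_def)
    qed
  qed
  ultimately show ?thesis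
    using D unfolding stanley_decomposition_def by blast
qed

end


section \<open>Edge ideals and their quotients\<close>

text \<open>
  Edge ideals are squarefree, so membership of a monomial depends on its support only.
\<close>

lemma edge_ideal_iff:
  assumes G: "simple_graph G"
  shows "edge_ideal G = {p :: ('v, 'k::field) mpoly. \<forall>u\<in>Poly_Mapping.keys p.
    Poly_Mapping.keys u \<in> dependent_sets (edges G) (verts G)}"
proof -
  let ?B = "{Poly_Mapping.single u (1::nat) + Poly_Mapping.single v 1 | u v. {u, v} \<in> edges G}"
  have "(\<exists>b\<in>?B. \<exists>t. u = t + b) \<longleftrightarrow> (\<exists>e\<in>edges G. e \<subseteq> Poly_Mapping.keys u)" for u :: "'v \<Rightarrow>\<^sub>0 nat"
  proof
    assume "\<exists>b\<in>?B. \<exists>t. u = t + b"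
    then obtain x y t where "{x, y} \<in> edges G"
      "u = t + (Poly_Mapping.single x 1 + Poly_Mapping.single y 1)" by blast
    then show "\<exists>e\<in>edges G. e \<subseteq> Poly_Mapping.keys u"
      by (intro bexI[of _ "{x, y}"]) (auto simp: keys_add_nat)
  next
    assume "\<exists>e\<in>edges G. e \<subseteq> Poly_Mapping.keys u"
    then obtain e where e: "e \<in> edges G" "e \<subseteq> Poly_Mapping.keys u" by blast
    then obtain x y where xy: "e = {x, y}" "x \<noteq> y"
      using G by (metis card_2_iff simple_graph_def)
    then have "Poly_Mapping.lookup (Poly_Mapping.single x 1 + Poly_Mapping.single y 1) v
        \<le> Poly_Mapping.lookup u v" for v
      using e(2) by (auto simp: lookup_add lookup_single when_def in_keys_iff Suc_le_eq)
    then obtain t where "u = t + (Poly_Mapping.single x 1 + Poly_Mapping.single y 1)"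
      using monomial_dividesE by blast
    then show "\<exists>b\<in>?B. \<exists>t. u = t + b" using e(1) xy(1) by blast
  qed
  then show ?thesis
    unfolding edge_ideal_eq_monomial_span(1)[OF G] monomial_span_def
    by (auto simp: dependent_sets_def polys_def)
qed

lemma ideal_edge_ideal:
  assumes "simple_graph G"
  shows "ideal (edge_ideal G :: ('v, 'k::field) mpoly set) (poly_ring (verts G))"
  unfolding edge_ideal_eq_monomial_span(1)[OF assms] by (rule ideal_monomial_span)

lemma monomial_basis_edge_ideal:
  assumes G: "simple_graph G"
  shows "monomial_basis (verts G)
    (ideal_module (poly_ring (verts G)) (edge_ideal G :: ('v, 'k::field) mpoly set))
    (ideal_component (verts G) (edge_ideal G)) (\<lambda>p. p)
    {u. Poly_Mapping.keys u \<in> dependent_sets (edges G) (verts G)}"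
proof (intro monomial_basis.intro multigraded_edge_ideal G monomial_basis_axioms.intro)
  show "bij_betw (\<lambda>p. p) {p. Poly_Mapping.keys p \<subseteq> {u. Poly_Mapping.keys u \<in> dependent_sets (edges G) (verts G)}}
     (carrier (ideal_module (poly_ring (verts G)) (edge_ideal G :: ('v, 'k) mpoly set)))"
    by (auto simp: ideal_module_def edge_ideal_iff[OF G] bij_betw_def inj_on_def)
qed (auto simp: ideal_module_def ideal_component_def edge_ideal_iff[OF G] poly_component_def
      dependent_sets_def intro: polys_single)

lemma monomial_basis_edge_quotient:
  assumes G: "simple_graph G"
  shows "monomial_basis (verts G)
    (quotient_module (poly_ring (verts G)) (edge_ideal G :: ('v, 'k::field) mpoly set))
    (quotient_component (verts G) (edge_ideal G)) (\<lambda>p. edge_ideal G +>\<^bsub>poly_ring (verts G)\<^esub> p)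
    {u. Poly_Mapping.keys u \<in> Pow (verts G) - dependent_sets (edges G) (verts G)}"
proof (intro monomial_basis.intro multigraded_edge_quotient G monomial_basis_axioms.intro)
  let ?I = "edge_ideal G :: ('v, 'k) mpoly set"
  let ?B = "{u. Poly_Mapping.keys u \<in> Pow (verts G) - dependent_sets (edges G) (verts G)}"
  let ?c = "\<lambda>p. ?I +>\<^bsub>poly_ring (verts G)\<^esub> p"
  have I: "ideal ?I (poly_ring (verts G))"
    by (rule ideal_edge_ideal[OF G])
  note ops = quotient_module_ops[OF I]
  have poly: "p \<in> polys (verts G)" if "Poly_Mapping.keys p \<subseteq> ?B" for p :: "('v, 'k) mpoly"
    using that by (auto simp: polys_def)
  show "?c (p + q) = ?c p \<oplus>\<^bsub>quotient_module (poly_ring (verts G)) ?I\<^esub> ?c q"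
    if "Poly_Mapping.keys p \<subseteq> ?B" "Poly_Mapping.keys q \<subseteq> ?B" for p q :: "('v, 'k) mpoly"
    using ops(3)[OF poly poly] that by simp
  show "p \<odot>\<^bsub>quotient_module (poly_ring (verts G)) ?I\<^esub> ?c q = ?c (p * q)"
    if "p \<in> polys (verts G)" "Poly_Mapping.keys q \<subseteq> ?B" for p q :: "('v, 'k) mpoly"
    using ops(4)[OF that(1) poly] that by simp
  show "?c (Poly_Mapping.single u 1) \<in> quotient_component (verts G) ?I (mdeg u)" if "u \<in> ?B" for u
    using that by (auto simp: quotient_component_def poly_component_def intro!: imageI polys_single)
  show "bij_betw ?c {p. Poly_Mapping.keys p \<subseteq> ?B} (carrier (quotient_module (poly_ring (verts G)) ?I))"
    unfolding bij_betw_def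
  proof
    show "inj_on ?c {p. Poly_Mapping.keys p \<subseteq> ?B}"
    proof (rule inj_onI; clarify)
      fix p q :: "('v, 'k) mpoly"
      assume pq: "Poly_Mapping.keys p \<subseteq> ?B" "Poly_Mapping.keys q \<subseteq> ?B" "?c p = ?c q"
      then have "p - q \<in> ?I" using ops(5)[OF poly poly] by simp
      moreover have "Poly_Mapping.keys (p - q) \<subseteq> ?B"
        using pq(1,2) keys_diff[of p q] by blast
      ultimately have "Poly_Mapping.keys (p - q) = {}"
        unfolding edge_ideal_iff[OF G] by blast
      then show "p = q" by simp
    qed
    show "?c ` {p. Poly_Mapping.keys p \<subseteq> ?B} = carrier (quotient_module (poly_ring (verts G)) ?I)"
    proof
      show "carrier (quotient_module (poly_ring (verts G)) ?I) \<subseteq> ?c ` {p. Poly_Mapping.keys p \<subseteq> ?B}"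
      proof
        fix x assume "x \<in> carrier (quotient_module (poly_ring (verts G)) ?I)"
        then obtain p where p: "p \<in> polys (verts G)" "x = ?c p" by (auto simp: ops(1))
        let ?p = "poly_restrict ?B p"
        have "Poly_Mapping.keys (p - ?p) \<subseteq> Poly_Mapping.keys p - ?B"
          by (auto simp: in_keys_iff lookup_minus lookup_poly_restrict split: if_splits)
        then have "p - ?p \<in> ?I"
          using p(1) by (auto simp: edge_ideal_iff[OF G] polys_def)
        moreover have "?p \<in> polys (verts G)" by (rule poly) (auto simp: keys_poly_restrict)
        ultimately have "x = ?c ?p" using ops(5)[OF p(1), of ?p] p(2) by simp
        then show "x \<in> ?c ` {p. Poly_Mapping.keys p \<subseteq> ?B}" by (auto simp: keys_poly_restrict)
      qed
    qed (use poly in \<open>auto simp: ops(1)\<close>)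
  qed
qed auto

context multigraded_module
begin

text \<open>
  Without summands the minimum in \<open>decomposition_sdepth\<close> would be taken over the empty set and say
  nothing.
\<close>

lemma stanley_decomposition_nonempty:
  assumes "stanley_decomposition V M gr r w A" "carrier M \<noteq> {\<zero>\<^bsub>M\<^esub>}"
  shows "1 \<le> r"
proof (rule ccontr)
  interpret module "poly_ring V" M by (rule is_module)
  assume "\<not> 1 \<le> r"
  then have "x = \<zero>\<^bsub>M\<^esub>" if "x \<in> carrier M" for x
    using assms(1) that unfolding stanley_decomposition_def direct_sum_def by auto
  then show False using assms(2) by blast
qed

lemma decomposition_sdepth_le:
  assumes "i \<in> {1..r}"
  shows "decomposition_sdepth r A \<le> card (A i)"
  using assms unfolding decomposition_sdepth_def by (intro Min_le) auto

text \<open>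
  The maximum in \<open>sdepth\<close> is meaningful because no decomposition exceeds the number of variables.
\<close>

lemma sdepth_ge:
  assumes dec: "stanley_decomposition V M gr r w A" and nz: "carrier M \<noteq> {\<zero>\<^bsub>M\<^esub>}"
    and "\<And>i. i \<in> {1..r} \<Longrightarrow> d \<le> card (A i)"
  shows "d \<le> sdepth V M gr"
proof -
  let ?S = "{decomposition_sdepth r A | r w A. stanley_decomposition V M gr r w A}"
  have "s \<le> card V" if "s \<in> ?S" for s
  proof -
    from that obtain r w A
      where s: "s = decomposition_sdepth r A" "stanley_decomposition V M gr r w A" by blast
    then have "1 \<in> {1..r}" using stanley_decomposition_nonempty[OF s(2) nz] by simp
    then have "s \<le> card (A 1)" "A 1 \<subseteq> V"
      using s decomposition_sdepth_le by (auto simp: stanley_decomposition_def)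
    then show ?thesis using finite_vars by (meson card_mono le_trans)
  qed
  then have "finite ?S" by (meson finite_nat_set_iff_bounded_le)
  have "d \<le> decomposition_sdepth r A"
    unfolding decomposition_sdepth_def
    using assms(3) stanley_decomposition_nonempty[OF dec nz] by (subst Min_ge_iff) auto
  also have "\<dots> \<le> sdepth V M gr"
    unfolding sdepth_def using dec by (intro Max_ge \<open>finite ?S\<close>) blast
  finally show ?thesis .
qed

text \<open>
  The given decomposition serves only to make the set under the maximum nonempty.
\<close>

lemma sdepth_le:
  assumes "stanley_decomposition V M gr r w A"
    and "\<And>r w A. stanley_decomposition V M gr r w A \<Longrightarrow> \<exists>i\<in>{1..r}. card (A i) \<le> d"
  shows "sdepth V M gr \<le> d"
proof -
  let ?S = "{decomposition_sdepth r A | r w A. stanley_decomposition V M gr r w A}"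
  have le: "s \<le> d" if "s \<in> ?S" for s
    using that assms(2) decomposition_sdepth_le by (smt (verit) le_trans mem_Collect_eq)
  then have "finite ?S" by (meson finite_nat_set_iff_bounded_le)
  moreover have "?S \<noteq> {}" using assms(1) by blast
  ultimately show ?thesis
    unfolding sdepth_def using le by (subst Max_le_iff) auto
qed

end

text \<open>
  The set \<open>D\<close> is a maximal independent set. Let \<open>u\<close> be the product of its variables. The class of \<open>u\<close> is
  nonzero, so some summand \<open>w K[A]\<close> has an element \<open>p w\<close> in whose representative \<open>u\<close> occurs; as \<open>w\<close> is homogeneous, \<open>u\<close> is, up to a scalar, a
  monomial of \<open>K[A]\<close> times \<open>w\<close>. If \<open>A\<close> contained a variable \<open>x\<close> outside \<open>D\<close>, then \<open>x u\<close> would be a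
  nonzero element of the quotient by freeness, although \<open>x\<close> has a neighbour in \<open>D\<close>.
\<close>

lemma quotient_stanley_space_bound:
  fixes G :: "'v ugraph"
  defines "V \<equiv> verts G" and "I \<equiv> (edge_ideal G :: ('v, 'k::field) mpoly set)"
  assumes G: "simple_graph G"
    and D: "D \<subseteq> V" "D \<notin> dependent_sets (edges G) V"
      "\<And>v. v \<in> V - D \<Longrightarrow> \<exists>u\<in>D. {u, v} \<in> edges G"
    and dec: "stanley_decomposition V (quotient_module (poly_ring V) I) (quotient_component V I) r w A"
  shows "\<exists>i\<in>{1..r}. A i \<subseteq> D"
proof -
  let ?M = "quotient_module (poly_ring V) I"
  let ?c = "\<lambda>p. I +>\<^bsub>poly_ring V\<^esub> p"
  have I: "ideal I (poly_ring V)"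
    unfolding V_def I_def by (rule ideal_edge_ideal[OF G])
  have I_iff: "p \<in> I \<longleftrightarrow> (\<forall>u\<in>Poly_Mapping.keys p. Poly_Mapping.keys u \<in> dependent_sets (edges G) V)" for p
    unfolding I_def V_def edge_ideal_iff[OF G] by simp
  note ops = quotient_module_ops[OF I]
  interpret module "poly_ring V" ?M by (rule module_quotient_module[OF I])
  have finD: "finite D" using D(1) G finite_subset by (auto simp: V_def simple_graph_def)
  let ?u = "squarefree_monomial D"
  have keys_u: "Poly_Mapping.keys ?u = D" by (rule keys_squarefree_monomial[OF finD])
  have u: "Poly_Mapping.single ?u 1 \<in> (polys V :: ('v, 'k) mpoly set)"
    using D(1) keys_u by (intro polys_single) simp
  then have "?c (Poly_Mapping.single ?u 1) \<in> carrier ?M" by (simp add: ops(1))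
  moreover have "direct_sum ?M {1..r} (\<lambda>i. stanley_space ?M (w i) (A i))"
    using dec by (simp add: stanley_decomposition_def)
  ultimately have "\<exists>!f. f \<in> Pi\<^sub>E {1..r} (\<lambda>i. stanley_space ?M (w i) (A i)) \<and>
      finite {i \<in> {1..r}. f i \<noteq> \<zero>\<^bsub>?M\<^esub>} \<and>
      ?c (Poly_Mapping.single ?u 1) = finsum ?M f {i \<in> {1..r}. f i \<noteq> \<zero>\<^bsub>?M\<^esub>}"
    unfolding direct_sum_def by (elim conjE) (erule bspec)
  then obtain f where f: "f \<in> Pi\<^sub>E {1..r} (\<lambda>i. stanley_space ?M (w i) (A i))"
    "?c (Poly_Mapping.single ?u 1) = finsum ?M f {i \<in> {1..r}. f i \<noteq> \<zero>\<^bsub>?M\<^esub>}"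
    by (elim ex1E conjE)
  let ?S = "{i \<in> {1..r}. f i \<noteq> \<zero>\<^bsub>?M\<^esub>}"
  have "\<forall>i\<in>{1..r}. \<exists>p m a. p \<in> polys (A i) \<and> m \<in> poly_component V a \<and> w i = ?c m \<and> f i = p \<odot>\<^bsub>?M\<^esub> w i"
  proof
    fix i assume i: "i \<in> {1..r}"
    then obtain a where "w i \<in> quotient_component V I a"
      using dec unfolding stanley_decomposition_def by blast
    then obtain m where m: "m \<in> poly_component V a" "w i = ?c m"
      by (auto simp: quotient_component_def)
    have "f i \<in> stanley_space ?M (w i) (A i)" using f(1) i by (auto simp: PiE_iff)
    then obtain p where "p \<in> polys (A i)" "f i = p \<odot>\<^bsub>?M\<^esub> w i" by (auto simp: stanley_space_def)
    with m show "\<exists>p m a. p \<in> polys (A i) \<and> m \<in> poly_component V a \<and> w i = ?c m \<and> f i = p \<odot>\<^bsub>?M\<^esub> w i"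
      by blast
  qed
  then obtain p m a where pm: "\<And>i. i \<in> {1..r} \<Longrightarrow> p i \<in> polys (A i) \<and> m i \<in> poly_component V (a i)
      \<and> w i = ?c (m i) \<and> f i = p i \<odot>\<^bsub>?M\<^esub> w i"
    by metis
  have A: "A i \<subseteq> V" if "i \<in> {1..r}" for i
    using dec that by (auto simp: stanley_decomposition_def)
  then have pV: "q \<in> polys V" if "i \<in> {1..r}" "q \<in> polys (A i)" for i and q :: "('v, 'k) mpoly"
    using that by (fastforce simp: polys_def)
  have mV: "m i \<in> polys V" if "i \<in> {1..r}" for i
    using pm[OF that] poly_component_subset by blast
  have smult_w: "q \<odot>\<^bsub>?M\<^esub> w i = ?c (q * m i)" if "i \<in> {1..r}" "q \<in> polys (A i)" for i q
    using ops(4)[OF pV[OF that] mV[OF that(1)]] pm[OF that(1)] by simp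
  have prod: "p i * m i \<in> polys V" if "i \<in> {1..r}" for i
    using pm[OF that] pV[OF that] mV[OF that] by (intro polys_mult) auto
  have f_eq: "f i = ?c (p i * m i)" if "i \<in> {1..r}" for i
    using pm[OF that] smult_w[OF that, of "p i"] by simp
  have "finsum ?M f ?S = finsum ?M (\<lambda>i. ?c (p i * m i)) ?S"
  proof (rule M.finsum_cong')
    show "(\<lambda>i. ?c (p i * m i)) \<in> ?S \<rightarrow> carrier ?M"
      using prod by (simp add: ops(1) Pi_iff)
    show "f i = ?c (p i * m i)" if "i \<in> ?S" for i
      by (rule f_eq) (use that in blast)
  qed simp
  then have "?c (Poly_Mapping.single ?u 1) = finsum ?M (\<lambda>i. ?c (p i * m i)) ?S"
    by (rule trans[OF f(2)])
  also have "\<dots> = ?c (\<Sum>i\<in>?S. p i * m i)"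
    using prod by (intro finsum_quotient[OF I]) (simp add: Pi_iff)
  finally have eq: "?c (Poly_Mapping.single ?u 1) = ?c (\<Sum>i\<in>?S. p i * m i)" .
  have sum: "(\<Sum>i\<in>?S. p i * m i) \<in> polys V"
    using prod by (intro polys_sum) simp
  have in_I: "Poly_Mapping.single ?u 1 - (\<Sum>i\<in>?S. p i * m i) \<in> I"
    using ops(5)[OF u sum] eq by simp
  have "?u \<notin> Poly_Mapping.keys (Poly_Mapping.single ?u 1 - (\<Sum>i\<in>?S. p i * m i))"
    using bspec[OF iffD1[OF I_iff in_I], of ?u] D(2) unfolding keys_u by blast
  then have one: "(\<Sum>i\<in>?S. Poly_Mapping.lookup (p i * m i) ?u) = 1"
    by (simp add: in_keys_iff lookup_minus lookup_sum)
  have "\<exists>i\<in>?S. Poly_Mapping.lookup (p i * m i) ?u \<noteq> 0"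
  proof (rule ccontr)
    assume "\<not> ?thesis"
    then have "(\<Sum>i\<in>?S. Poly_Mapping.lookup (p i * m i) ?u) = 0" by (intro sum.neutral) blast
    with one show False by simp
  qed
  then obtain i where i: "i \<in> {1..r}" "Poly_Mapping.lookup (p i * m i) ?u \<noteq> 0" by blast
  then have "?u \<in> Poly_Mapping.keys (p i * m i)" by (simp add: in_keys_iff)
  then obtain s t where st: "?u = s + t" "s \<in> Poly_Mapping.keys (p i)" "t \<in> Poly_Mapping.keys (m i)"
    using keys_mult[of "p i" "m i"] by blast
  have "A i \<subseteq> D"
  proof
    fix x assume x: "x \<in> A i"
    show "x \<in> D"
    proof (rule ccontr)
      assume "x \<notin> D"
      then obtain y where y: "y \<in> D" "{y, x} \<in> edges G" using D(3) x A[OF i(1)] by blast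
      let ?q = "Poly_Mapping.single (Poly_Mapping.single x 1 + s) 1 :: ('v, 'k) mpoly"
      have q: "?q \<in> polys (A i)"
        using pm[OF i(1)] st(2) x by (intro polys_single) (auto simp: keys_add_nat polys_def)
      \<comment> \<open>The homogeneous representative of \<open>w i\<close> has \<open>t\<close> as its only monomial, so \<open>?q\<close> moves it to \<open>x u\<close>.\<close>
      have "v = Poly_Mapping.single x 1 + ?u" if "v \<in> Poly_Mapping.keys (?q * m i)" for v
      proof -
        from that keys_mult[of ?q "m i"] obtain t'
          where t': "v = Poly_Mapping.single x 1 + s + t'" "t' \<in> Poly_Mapping.keys (m i)" by auto
        then have "t' = t"
          using pm[OF i(1)] st(3) by (intro inj_mdeg) (auto simp: poly_component_def)
        with t'(1) st(1) show ?thesis by (simp add: add.assoc)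
      qed
      moreover have dep: "Poly_Mapping.keys (Poly_Mapping.single x 1 + ?u) \<in> dependent_sets (edges G) V"
        using y x A[OF i(1)] D(1) by (auto simp: keys_add_nat keys_u dependent_sets_def intro!: bexI[of _ "{y, x}"])
      ultimately have "?q * m i \<in> I"
        using dep by (intro iffD2[OF I_iff]) blast
      then have "?c (?q * m i) = ?c (0 * m i)"
        using polys_mult[OF pV[OF i(1) q] mV[OF i(1)]] by (subst ops(5)) (auto simp: polys_zero)
      then have "?q \<odot>\<^bsub>?M\<^esub> w i = 0 \<odot>\<^bsub>?M\<^esub> w i"
        using smult_w[OF i(1) q] smult_w[OF i(1) polys_zero] by simp
      moreover have "inj_on (\<lambda>p. p \<odot>\<^bsub>?M\<^esub> w i) (polys (A i))"
        using dec i(1) by (auto simp: stanley_decomposition_def)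
      ultimately have "?q = 0" using q polys_zero by (auto dest: inj_onD)
      then show False by (metis lookup_single_eq lookup_zero zero_neq_one)
    qed
  qed
  with i(1) show ?thesis by blast
qed


lemma sdepth_edge_ideal_ge:
  assumes G: "simple_graph G" and "edges G \<noteq> {}"
    and "interval_partition d (dependent_sets (edges G) (verts G))"
  shows "d \<le> sdepth_ideal (verts G) (edge_ideal G :: ('v, 'k::field) mpoly set)"
proof -
  let ?F = "dependent_sets (edges G) (verts G)" and ?I = "edge_ideal G :: ('v, 'k) mpoly set"
  let ?M = "ideal_module (poly_ring (verts G)) ?I"
  interpret monomial_basis "verts G" ?M "ideal_component (verts G) ?I" "\<lambda>p. p"
    "{u. Poly_Mapping.keys u \<in> ?F}"
    by (rule monomial_basis_edge_ideal[OF G])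
  obtain r :: nat and C D where CD: "\<And>i. i \<in> {1..r} \<Longrightarrow> C i \<subseteq> D i \<and> d \<le> card (D i)"
    "disjoint_family_on (\<lambda>i. {C i..D i}) {1..r}" "?F = (\<Union>i\<in>{1..r}. {C i..D i})"
    by (rule interval_partition_indexed[OF assms(3)]) (rule that)
  have D: "D i \<subseteq> verts G" if "i \<in> {1..r}" for i
  proof -
    have "D i \<in> ?F" unfolding CD(3) using CD(1)[OF that] that by (intro UN_I[of i]) auto
    then show ?thesis by (simp add: dependent_sets_def)
  qed
  have dec: "stanley_decomposition (verts G) ?M (ideal_component (verts G) ?I) r
    (\<lambda>i. Poly_Mapping.single (squarefree_monomial (C i)) 1) D"
    by (rule stanley_decomposition_of_intervals) (use CD D in auto)
  obtain e where e: "e \<in> edges G" using assms(2) by blast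
  then have "e \<subseteq> verts G" "finite e"
    using G finite_subset by (auto simp: simple_graph_def)
  then have "Poly_Mapping.single (squarefree_monomial e) 1 \<in> ?I"
    using e by (auto simp: edge_ideal_iff[OF G] keys_squarefree_monomial dependent_sets_def)
  moreover have "Poly_Mapping.single (squarefree_monomial e) 1 \<noteq> (0 :: ('v, 'k) mpoly)"
    by (metis lookup_single_eq lookup_zero zero_neq_one)
  ultimately have "carrier ?M \<noteq> {\<zero>\<^bsub>?M\<^esub>}"
    by (auto simp: ideal_module_def)
  then show ?thesis
    unfolding sdepth_ideal_def using CD(1) by (intro sdepth_ge[OF dec]) auto
qed

lemma sdepth_edge_quotient_le:
  assumes G: "simple_graph G"
    and "D \<subseteq> verts G" "D \<notin> dependent_sets (edges G) (verts G)"
    and "\<And>v. v \<in> verts G - D \<Longrightarrow> \<exists>u\<in>D. {u, v} \<in> edges G"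
  shows "sdepth_quotient (verts G) (edge_ideal G :: ('v, 'k::field) mpoly set) \<le> card D"
proof -
  let ?F = "Pow (verts G) - dependent_sets (edges G) (verts G)"
  let ?I = "edge_ideal G :: ('v, 'k) mpoly set"
  let ?M = "quotient_module (poly_ring (verts G)) ?I"
  interpret monomial_basis "verts G" ?M "quotient_component (verts G) ?I"
    "\<lambda>p. ?I +>\<^bsub>poly_ring (verts G)\<^esub> p" "{u. Poly_Mapping.keys u \<in> ?F}"
    by (rule monomial_basis_edge_quotient[OF G])
  have part: "interval_partition 0 ?F"
    by (rule interval_partition_singletons[OF finite_vars]) blast
  obtain r :: nat and A B where AB: "\<And>i. i \<in> {1..r} \<Longrightarrow> A i \<subseteq> B i \<and> 0 \<le> card (B i)"
    "disjoint_family_on (\<lambda>i. {A i..B i}) {1..r}" "?F = (\<Union>i\<in>{1..r}. {A i..B i})"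
    by (rule interval_partition_indexed[OF part]) (rule that)
  have B: "B i \<subseteq> verts G" if "i \<in> {1..r}" for i
  proof -
    have "B i \<in> ?F" unfolding AB(3) using AB(1)[OF that] that by (intro UN_I[of i]) auto
    then show ?thesis by blast
  qed
  have dec: "stanley_decomposition (verts G) ?M (quotient_component (verts G) ?I) r
    (\<lambda>i. ?I +>\<^bsub>poly_ring (verts G)\<^esub> Poly_Mapping.single (squarefree_monomial (A i)) 1) B"
    by (rule stanley_decomposition_of_intervals) (use AB B in auto)
  have "finite D" using finite_subset[OF assms(2) finite_vars] .
  show ?thesis
    unfolding sdepth_quotient_def
  proof (rule sdepth_le[OF dec])
    fix r w A
    assume "stanley_decomposition (verts G) ?M (quotient_component (verts G) ?I) r w A"
    then obtain i where "i \<in> {1..r}" "A i \<subseteq> D"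
      using quotient_stanley_space_bound[OF assms] by blast
    then show "\<exists>i\<in>{1..r}. card (A i) \<le> card D"
      using card_mono[OF \<open>finite D\<close>] by blast
  qed
qed

section \<open>The strong product of a path with the path on three vertices\<close>

lemma strong_path_edge_rows:
  assumes "{u, v} \<in> edges (strong_path n m)"
  shows "fst v \<le> Suc (fst u)"
proof -
  have "{(fst u, snd u), (fst v, snd v)} \<in> edges (strong_path n m)" using assms by simp
  then show ?thesis unfolding strong_path_edge_iff by linarith
qed

lemma sdepth_edge_ideal_strong_path_ge:
  assumes "n \<ge> 1"
  shows "(n + 2) div 3 + 1 \<le> sdepth_ideal (verts (strong_path n 3))
    (edge_ideal (strong_path n 3) :: (nat \<times> nat, 'k::field) mpoly set)"
proof (rule sdepth_edge_ideal_ge[OF simple_graph_strong_path])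
  let ?G = "strong_path n 3"
  have e: "{(n, 1), (n, 2)} \<in> edges ?G"
    using assms by (simp add: strong_path_edge_iff)
  then show "edges ?G \<noteq> {}" by blast
  have "interval_partition (Suc ((n - 1 + 3) div 3)) (dependent_sets (edges ?G) (verts ?G))"
  proof (rule interval_partition_levels[where level = fst])
    show "\<forall>e\<in>edges ?G. card e = 2"
      using simple_graph_strong_path[of n 3] by (auto simp: simple_graph_def)
    show "fst v \<le> Suc (fst u)" if "{u, v} \<in> edges ?G" for u v
      by (rule strong_path_edge_rows[OF that])
    show "\<exists>v\<in>verts ?G. fst v = i" if "1 \<le> i" "i \<le> n" for i
      by (rule bexI[of _ "(i, 1)"]) (use that in \<open>auto simp: strong_path_verts\<close>)
  qed (use assms in \<open>auto simp: strong_path_verts\<close>)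
  moreover have "Suc ((n - 1 + 3) div 3) = (n + 2) div 3 + 1" using assms by simp
  ultimately show "interval_partition ((n + 2) div 3 + 1) (dependent_sets (edges ?G) (verts ?G))"
    by simp
qed

text \<open>
  The vertices \<open>x j\<close> in the rows \<open>2, 5, 8, \<dots>\<close> of the middle column form a maximal independent set. If the
  last block has one row only, its vertex is taken from row \<open>n\<close>, hence the minimum in the definition
  of \<open>x\<close>.
\<close>

lemma sdepth_edge_quotient_strong_path_le:
  assumes "n \<ge> 1"
  shows "sdepth_quotient (verts (strong_path n 3))
    (edge_ideal (strong_path n 3) :: (nat \<times> nat, 'k::field) mpoly set) \<le> (n + 2) div 3"
proof -
  let ?G = "strong_path n 3"
  define k where "k = (n + 2) div 3"
  define x where "x j = (min (3 * j + 2) n, 2 :: nat)" for j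
  define D where "D = x ` {..<k}"
  have j: "3 * j + 1 \<le> n" if "j < k" for j using that by (simp add: k_def)
  have "sdepth_quotient (verts ?G) (edge_ideal ?G :: (nat \<times> nat, 'k) mpoly set) \<le> card D"
  proof (rule sdepth_edge_quotient_le[OF simple_graph_strong_path])
    show "D \<subseteq> verts ?G"
      using assms by (auto simp: D_def x_def strong_path_verts)
    have far: "{x i, x j} \<notin> edges ?G" if "i < k" "j < k" for i j
    proof (cases i j rule: linorder_cases)
      case less
      then have "fst (x i) + 2 \<le> fst (x j)" using j[OF that(2)] by (simp add: x_def min_def)
      then show ?thesis using strong_path_edge_rows[of "x i" "x j"] by fastforce
    next
      case greater
      then have "fst (x j) + 2 \<le> fst (x i)" using j[OF that(1)] by (simp add: x_def min_def)
      then show ?thesis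
        using strong_path_edge_rows[of "x j" "x i"] by (fastforce simp: insert_commute)
    next
      case equal
      then show ?thesis using simple_graph_strong_path[of n 3] by (force simp: simple_graph_def)
    qed
    show "D \<notin> dependent_sets (edges ?G) (verts ?G)"
    proof
      assume "D \<in> dependent_sets (edges ?G) (verts ?G)"
      then obtain e where e: "e \<in> edges ?G" "e \<subseteq> D" by (auto simp: dependent_sets_def)
      then obtain u v where "e = {u, v}"
        using simple_graph_strong_path[of n 3] by (metis card_2_iff simple_graph_def)
      with e far show False by (auto simp: D_def)
    qed
    fix v assume v: "v \<in> verts ?G - D"
    then obtain a b where ab: "v = (a, b)" "a \<in> {1..n}" "b \<in> {1..3}"
      by (auto simp: strong_path_verts)
    \<comment> \<open>The block of three rows that contains row \<open>a\<close>, counted from zero.\<close>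
    define j where "j = (a - 1) div 3"
    have "j < k" using ab(2) by (auto simp: j_def k_def)
    then have "x j \<in> D" by (simp add: D_def)
    then have "x j \<noteq> v" using v by blast
    moreover have "3 * j + 1 \<le> a" "a \<le> 3 * j + 3" using ab(2) by (auto simp: j_def)
    ultimately have "{x j, v} \<in> edges ?G"
      using ab unfolding x_def ab(1) strong_path_edge_iff by auto
    with \<open>x j \<in> D\<close> show "\<exists>u\<in>D. {u, v} \<in> edges ?G" by blast
  qed
  also have "card D \<le> k"
    unfolding D_def using card_image_le[of "{..<k}" x] by simp
  finally show ?thesis by (simp add: k_def)
qed

theorem theorem4p5:
  fixes n :: nat
  assumes "n \<ge> 1"
  shows "sdepth_ideal (verts (strong_path n 3))
           (edge_ideal (strong_path n 3) :: (nat \<times> nat, 'k::field) mpoly set)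
         > sdepth_quotient (verts (strong_path n 3))
           (edge_ideal (strong_path n 3) :: (nat \<times> nat, 'k::field) mpoly set)"
  using sdepth_edge_ideal_strong_path_ge[OF assms, where 'k = 'k]
    sdepth_edge_quotient_strong_path_le[OF assms, where 'k = 'k] by linarith

end
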